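(* Let $(M,J_0)$ be a parallelizable almost complex manifold of real dimension $2m$, and let $\{\phi^j\}_{j=1}^m$ be a co-frame of $(1,0)$-forms for $J_0$. Let $f^j_k \in C^\infty(M)$, $j,k=1,\dots,m$, be complex-valued smooth functions, and assume that $J_1$ is an almost complex structure on $M$ defined by the co-frame of $(1,0)$-forms $$\omega^j := \phi^j + \sum_{k=1}^m f^j_k\, \phi^{\bar k}, \qquad j=1,\dots,m.$$ For $s\in\mathbb{C}$ with $|s|<\epsilon$, where $\epsilon>0$ is sufficiently small (in particular so that the following forms and their conjugates are linearly independent at every point), consider the curve of almost complex structures $J(s)$ on $M$ defined by the co-frame of $(1,0)$-forms $$\omega^j_s := \phi^j + s \sum_{k=1}^m f^j_k\, \phi^{\bar k}, \qquad j=1,\dots,m.$$ Then for $0<|s|<\epsilon$ $$\operatorname{rk} N_{J(s)}|_x \ge \max\{\operatorname{rk} N_{J_0}|_x,\ \operatorname{rk} N_{J_1}|_x\}$$ at every point $x\in M$.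
   Context: $\phi^{\bar k}$ denotes the complex conjugate $\overline{\phi^k}$. A co-frame of $(1,0)$-forms of an almost complex structure on a $2m$-manifold is a set of $m$ global complex $1$-forms that is a basis of the $(1,0)$-forms at every point. Conversely, declaring $m$ complex $1$-forms to be of type $(1,0)$ defines a unique almost complex structure provided that these forms together with their conjugates are linearly independent at every point. For an almost complex structure $J$, let $A^{p,q}$ be the bundle of $(p,q)$-forms and $\pi^{0,2}$ the projection of complex $2$-forms onto $(0,2)$-forms. The operator $\bar\mu := \pi^{0,2}\circ d\colon A^{1,0}\to A^{0,2}$ is $C^\infty(M)$-linear, hence defines a complex linear map $A^{1,0}_x\to A^{0,2}_x$ for each $x \in M$. The rank of the Nijenhuis tensor at $x$, $\operatorname{rk} N_J|_x$, is by definition the complex rank of $\bar\mu\colon A^{1,0}_x\to A^{0,2}_x$.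
   Formalization: The bound ε for the rank inequality is chosen separately for each point x (at most the ε for which all J(s) exist on M); a single ε valid at every x of M does not exist in general, even for compact M. *)

theory Defs
  imports "HOL-Analysis.Analysis" "HOL-Library.Function_Algebras"
begin

section \<open>Smooth manifolds\<close>

text \<open>The predicate \<open>Ck_on k S f\<close> is meant for open \<open>S\<close> only.\<close>

primrec Ck_on ::
  "nat \<Rightarrow> 'e::euclidean_space set \<Rightarrow> ('e \<Rightarrow> 'b::real_normed_vector) \<Rightarrow> bool" where
  "Ck_on 0 S f \<longleftrightarrow> continuous_on S f"
| "Ck_on (Suc k) S f \<longleftrightarrow>
     (\<forall>y\<in>S. f differentiable (at y)) \<and>
     (\<forall>v. Ck_on k S (\<lambda>y. frechet_derivative f (at y) v))"

definition smooth_on :: "'e::euclidean_space set \<Rightarrow> ('e \<Rightarrow> 'b::real_normed_vector) \<Rightarrow> bool" where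
  "smooth_on S f \<longleftrightarrow> (\<forall>k. Ck_on k S f)"

text \<open>A chart is a pair of its domain and its coordinate map; the values of the coordinate
  map outside the domain are irrelevant.\<close>

type_synonym ('a, 'e) chart = "'a set \<times> ('a \<Rightarrow> 'e)"

definition chart_image :: "('a, 'e) chart \<Rightarrow> 'e set" where
  "chart_image c = snd c ` fst c"

definition chart_inv :: "('a, 'e) chart \<Rightarrow> 'e \<Rightarrow> 'a" where
  "chart_inv c = inv_into (fst c) (snd c)"

text \<open>The atlas need not be maximal.\<close>

definition smooth_manifold :: "'a topology \<Rightarrow> ('a, 'e::euclidean_space) chart set \<Rightarrow> bool" where
  "smooth_manifold X A \<longleftrightarrow>
     Hausdorff_space X \<and> second_countable X \<and>
     (\<Union>c\<in>A. fst c) = topspace X \<and>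
     (\<forall>c\<in>A. openin X (fst c) \<and> open (chart_image c) \<and>
        homeomorphic_map (subtopology X (fst c)) (top_of_set (chart_image c)) (snd c)) \<and>
     (\<forall>c\<in>A. \<forall>c'\<in>A. smooth_on (snd c ` (fst c \<inter> fst c')) (snd c' \<circ> chart_inv c))"

definition smooth_fun ::
  "('a, 'e::euclidean_space) chart set \<Rightarrow> ('a \<Rightarrow> complex) \<Rightarrow> bool" where
  "smooth_fun A f \<longleftrightarrow> (\<forall>c\<in>A. smooth_on (chart_image c) (f \<circ> chart_inv c))"


section \<open>Tangent vectors\<close>

definition charts_at :: "('a, 'e) chart set \<Rightarrow> 'a \<Rightarrow> ('a, 'e) chart set" where
  "charts_at A x = {c \<in> A. x \<in> fst c}"

definition transition_deriv ::
  "('a, 'e::euclidean_space) chart \<Rightarrow> ('a, 'e) chart \<Rightarrow> 'a \<Rightarrow> 'e \<Rightarrow> 'e" where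
  "transition_deriv c c' x = frechet_derivative (snd c' \<circ> chart_inv c) (at (snd c x))"

text \<open>A tangent vector at \<open>x\<close> is the family of its coordinate representations in all charts
  around \<open>x\<close>, which are related by the derivatives of the coordinate changes. The value 0 for
  the remaining charts makes this family unique.\<close>

type_synonym ('a, 'e) tvec = "('a, 'e) chart \<Rightarrow> 'e"

definition tangent_space ::
  "('a, 'e::euclidean_space) chart set \<Rightarrow> 'a \<Rightarrow> ('a, 'e) tvec set" where
  "tangent_space A x =
     {\<xi>. (\<forall>c\<in>charts_at A x. \<forall>c'\<in>charts_at A x. \<xi> c' = transition_deriv c c' x (\<xi> c)) \<and>
         (\<forall>c. c \<notin> charts_at A x \<longrightarrow> \<xi> c = 0)}"

text \<open>The tangent vector at \<open>x\<close> whose representation in the chart \<open>c\<close> is \<open>v\<close>.\<close>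

definition coord_vec ::
  "('a, 'e::euclidean_space) chart set \<Rightarrow> ('a, 'e) chart \<Rightarrow> 'a \<Rightarrow> 'e \<Rightarrow> ('a, 'e) tvec" where
  "coord_vec A c x v = (\<lambda>c'. if c' \<in> charts_at A x then transition_deriv c c' x v else 0)"

definition tscale :: "real \<Rightarrow> ('a, 'e::euclidean_space) tvec \<Rightarrow> ('a, 'e) tvec" where
  "tscale r \<xi> = (\<lambda>c. r *\<^sub>R \<xi> c)"

definition smooth_vector_field ::
  "'a topology \<Rightarrow> ('a, 'e::euclidean_space) chart set \<Rightarrow> ('a \<Rightarrow> ('a, 'e) tvec) \<Rightarrow> bool" where
  "smooth_vector_field X A E \<longleftrightarrow>
     (\<forall>x\<in>topspace X. E x \<in> tangent_space A x) \<and>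
     (\<forall>c\<in>A. smooth_on (chart_image c) (\<lambda>y. E (chart_inv c y) c))"

definition parallelizable :: "'a topology \<Rightarrow> ('a, 'e::euclidean_space) chart set \<Rightarrow> bool" where
  "parallelizable X A \<longleftrightarrow>
     (\<exists>E :: nat \<Rightarrow> 'a \<Rightarrow> ('a, 'e) tvec.
        (\<forall>i<DIM('e). smooth_vector_field X A (E i)) \<and>
        (\<forall>x\<in>topspace X. \<forall>\<xi>\<in>tangent_space A x.
           \<exists>!r. r \<in> extensional {..<DIM('e)} \<and> \<xi> = (\<Sum>i<DIM('e). tscale (r i) (E i x))))"


section \<open>Almost complex structures\<close>

definition almost_complex_structure ::
  "'a topology \<Rightarrow> ('a, 'e::euclidean_space) chart set \<Rightarrow>
   ('a \<Rightarrow> ('a, 'e) tvec \<Rightarrow> ('a, 'e) tvec) \<Rightarrow> bool" where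
  "almost_complex_structure X A J \<longleftrightarrow>
     (\<forall>x\<in>topspace X.
        (\<forall>\<xi>\<in>tangent_space A x. J x \<xi> \<in> tangent_space A x \<and> J x (J x \<xi>) = - \<xi>) \<and>
        (\<forall>\<xi>\<in>tangent_space A x. \<forall>\<eta>\<in>tangent_space A x. J x (\<xi> + \<eta>) = J x \<xi> + J x \<eta>) \<and>
        (\<forall>r. \<forall>\<xi>\<in>tangent_space A x. J x (tscale r \<xi>) = tscale r (J x \<xi>))) \<and>
     (\<forall>c\<in>A. \<forall>v. smooth_on (chart_image c)
        (\<lambda>y. J (chart_inv c y) (coord_vec A c (chart_inv c y) v) c))"


section \<open>Complex forms\<close>

text \<open>The complex vector space of all complex-valued functions on a fixed set of arguments.
  Values of 1-forms and 2-forms at a point are elements of such spaces.\<close>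

global_interpretation cfun: vector_space "\<lambda>(z::complex) f (i::'i). z * f i"
  by unfold_locales (auto simp: fun_eq_iff algebra_simps)

text \<open>Complex covectors vanish outside the tangent space, so that they are determined by their
  values on it.\<close>

definition covectors ::
  "('a, 'e::euclidean_space) chart set \<Rightarrow> 'a \<Rightarrow> (('a, 'e) tvec \<Rightarrow> complex) set" where
  "covectors A x =
     {a. (\<forall>\<xi>\<in>tangent_space A x. \<forall>\<eta>\<in>tangent_space A x. a (\<xi> + \<eta>) = a \<xi> + a \<eta>) \<and>
         (\<forall>r. \<forall>\<xi>\<in>tangent_space A x. a (tscale r \<xi>) = complex_of_real r * a \<xi>) \<and>
         (\<forall>\<xi>. \<xi> \<notin> tangent_space A x \<longrightarrow> a \<xi> = 0)}"

definition covectors10 ::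
  "('a, 'e::euclidean_space) chart set \<Rightarrow> ('a \<Rightarrow> ('a, 'e) tvec \<Rightarrow> ('a, 'e) tvec) \<Rightarrow> 'a \<Rightarrow>
   (('a, 'e) tvec \<Rightarrow> complex) set" where
  "covectors10 A J x = {a \<in> covectors A x. \<forall>\<xi>\<in>tangent_space A x. a (J x \<xi>) = \<i> * a \<xi>}"

definition form_coord ::
  "('a, 'e::euclidean_space) chart set \<Rightarrow> ('a, 'e) chart \<Rightarrow>
   ('a \<Rightarrow> ('a, 'e) tvec \<Rightarrow> complex) \<Rightarrow> 'e \<Rightarrow> 'e \<Rightarrow> complex" where
  "form_coord A c \<alpha> v y = \<alpha> (chart_inv c y) (coord_vec A c (chart_inv c y) v)"

definition smooth_form ::
  "'a topology \<Rightarrow> ('a, 'e::euclidean_space) chart set \<Rightarrow>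
   ('a \<Rightarrow> ('a, 'e) tvec \<Rightarrow> complex) \<Rightarrow> bool" where
  "smooth_form X A \<alpha> \<longleftrightarrow>
     (\<forall>x\<in>topspace X. \<alpha> x \<in> covectors A x) \<and>
     (\<forall>c\<in>A. \<forall>v. smooth_on (chart_image c) (form_coord A c \<alpha> v))"

definition smooth_form10 ::
  "'a topology \<Rightarrow> ('a, 'e::euclidean_space) chart set \<Rightarrow>
   ('a \<Rightarrow> ('a, 'e) tvec \<Rightarrow> ('a, 'e) tvec) \<Rightarrow> ('a \<Rightarrow> ('a, 'e) tvec \<Rightarrow> complex) \<Rightarrow> bool" where
  "smooth_form10 X A J \<alpha> \<longleftrightarrow>
     smooth_form X A \<alpha> \<and> (\<forall>x\<in>topspace X. \<alpha> x \<in> covectors10 A J x)"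

text \<open>The formula \<open>d\<alpha>(V, W) = V(\<alpha>(W)) - W(\<alpha>(V)) - \<alpha>([V, W])\<close> for the coordinate fields \<open>V, W\<close>
  of a chart around \<open>x\<close>, whose bracket vanishes. The value does not depend on the chart.\<close>

definition ext_deriv ::
  "('a, 'e::euclidean_space) chart set \<Rightarrow> ('a \<Rightarrow> ('a, 'e) tvec \<Rightarrow> complex) \<Rightarrow>
   'a \<Rightarrow> ('a, 'e) tvec \<times> ('a, 'e) tvec \<Rightarrow> complex" where
  "ext_deriv A \<alpha> x = (\<lambda>(\<xi>, \<eta>).
     if \<xi> \<in> tangent_space A x \<and> \<eta> \<in> tangent_space A x then
       (let c = (SOME c. c \<in> charts_at A x) in
          frechet_derivative (form_coord A c \<alpha> (\<eta> c)) (at (snd c x)) (\<xi> c) -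
          frechet_derivative (form_coord A c \<alpha> (\<xi> c)) (at (snd c x)) (\<eta> c))
     else 0)"

text \<open>The projection of a 2-covector \<open>b\<close> onto its (0,2)-part is \<open>b(P \<xi>, P \<eta>)\<close> for the projection
  \<open>P = (1 + \<i> J) / 2\<close> of the complexified tangent space onto the vectors of type (0,1),
  expanded by complex bilinearity.\<close>

definition proj02 ::
  "('a, 'e::euclidean_space) chart set \<Rightarrow> ('a \<Rightarrow> ('a, 'e) tvec \<Rightarrow> ('a, 'e) tvec) \<Rightarrow> 'a \<Rightarrow>
   (('a, 'e) tvec \<times> ('a, 'e) tvec \<Rightarrow> complex) \<Rightarrow> ('a, 'e) tvec \<times> ('a, 'e) tvec \<Rightarrow> complex" where
  "proj02 A J x b = (\<lambda>(\<xi>, \<eta>).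
     if \<xi> \<in> tangent_space A x \<and> \<eta> \<in> tangent_space A x then
       (b (\<xi>, \<eta>) + \<i> * b (J x \<xi>, \<eta>) + \<i> * b (\<xi>, J x \<eta>) - b (J x \<xi>, J x \<eta>)) / 4
     else 0)"

definition mubar ::
  "('a, 'e::euclidean_space) chart set \<Rightarrow> ('a \<Rightarrow> ('a, 'e) tvec \<Rightarrow> ('a, 'e) tvec) \<Rightarrow>
   ('a \<Rightarrow> ('a, 'e) tvec \<Rightarrow> complex) \<Rightarrow> 'a \<Rightarrow> ('a, 'e) tvec \<times> ('a, 'e) tvec \<Rightarrow> complex" where
  "mubar A J \<alpha> x = proj02 A J x (ext_deriv A \<alpha> x)"

text \<open>The linear map induced by \<open>mubar\<close> on the fibre at \<open>x\<close>: a (1,0)-covector is extended to a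
  (1,0)-form; by tensoriality the result does not depend on the extension.\<close>

definition mubar_at ::
  "'a topology \<Rightarrow> ('a, 'e::euclidean_space) chart set \<Rightarrow>
   ('a \<Rightarrow> ('a, 'e) tvec \<Rightarrow> ('a, 'e) tvec) \<Rightarrow> 'a \<Rightarrow>
   (('a, 'e) tvec \<Rightarrow> complex) \<Rightarrow> ('a, 'e) tvec \<times> ('a, 'e) tvec \<Rightarrow> complex" where
  "mubar_at X A J x a = (THE b. \<exists>\<alpha>. smooth_form10 X A J \<alpha> \<and> \<alpha> x = a \<and> mubar A J \<alpha> x = b)"

definition nijenhuis_rank ::
  "'a topology \<Rightarrow> ('a, 'e::euclidean_space) chart set \<Rightarrow>
   ('a \<Rightarrow> ('a, 'e) tvec \<Rightarrow> ('a, 'e) tvec) \<Rightarrow> 'a \<Rightarrow> nat" where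
  "nijenhuis_rank X A J x = cfun.dim (mubar_at X A J x ` covectors10 A J x)"

definition coframe10 ::
  "'a topology \<Rightarrow> ('a, 'e::euclidean_space) chart set \<Rightarrow>
   ('a \<Rightarrow> ('a, 'e) tvec \<Rightarrow> ('a, 'e) tvec) \<Rightarrow> nat \<Rightarrow>
   (nat \<Rightarrow> 'a \<Rightarrow> ('a, 'e) tvec \<Rightarrow> complex) \<Rightarrow> bool" where
  "coframe10 X A J m \<phi> \<longleftrightarrow>
     (\<forall>j\<in>{1..m}. smooth_form X A (\<phi> j)) \<and>
     (\<forall>x\<in>topspace X.
        inj_on (\<lambda>j. \<phi> j x) {1..m} \<and>
        cfun.independent ((\<lambda>j. \<phi> j x) ` {1..m}) \<and>
        cfun.span ((\<lambda>j. \<phi> j x) ` {1..m}) = covectors10 A J x)"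

definition deformed_coframe ::
  "nat \<Rightarrow> (nat \<Rightarrow> 'a \<Rightarrow> ('a, 'e) tvec \<Rightarrow> complex) \<Rightarrow> (nat \<Rightarrow> nat \<Rightarrow> 'a \<Rightarrow> complex) \<Rightarrow> complex \<Rightarrow>
   nat \<Rightarrow> 'a \<Rightarrow> ('a, 'e) tvec \<Rightarrow> complex" where
  "deformed_coframe m \<phi> f s = (\<lambda>j x \<xi>. \<phi> j x \<xi> + s * (\<Sum>k=1..m. f j k x * cnj (\<phi> k x \<xi>)))"

end

theory Submission
  imports Defs
begin

text \<open>
  Fix a point \<open>x\<close> and write \<open>\<omega>\<^sub>s\<close> for the co-frame of \<open>J(s)\<close>. Since \<open>\<omega>\<^sub>s = (1 - s) \<omega>\<^sub>0 + s \<omega>\<^sub>1\<close>, the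
  2-forms \<open>d\<omega>\<^sub>s\<close> at \<open>x\<close> are affine functions of \<open>s\<close>. The rank of the Nijenhuis tensor at \<open>x\<close> is the
  dimension of the span of the (0,2)-parts of the forms \<open>d\<omega>\<^sub>s\<^sup>j\<close>
  (\<open>nijenhuis_rank_eq_dim_mubar\<close>), and the (0,2)-part of a 2-form is its restriction to vectors of
  type (0,1). So it suffices to describe the (0,1)-vectors of \<open>J(s)\<close> polynomially in \<open>s\<close>: then
  linear independence of these restrictions for one parameter value implies it for all but
  finitely many values, because it amounts to a minor, a polynomial in \<open>s\<close>, not vanishing
  (\<open>finite_dependent_parameters\<close>). As this works equally from \<open>s = 0\<close> and from \<open>s = 1\<close>, both
  ranks are lower bounds for every admissible \<open>s\<close> outside a finite set, in particular for all
  small \<open>s \<noteq> 0\<close>.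

  The (0,1)-vectors are found as follows. A complexified vector \<open>Z\<close> is annihilated by \<open>\<omega>\<^sub>s\<close> iff
  \<open>\<phi>(Z) = - s F \<psi>(Z)\<close>, where \<open>\<psi>\<^sup>k\<close> is the conjugate form of \<open>\<phi>\<^sup>k\<close> and \<open>F\<close> is the matrix of the values
  \<open>f\<^sup>j\<^sub>k(x)\<close>. If \<open>Z\<^sub>1\<close> is of type (0,1) for \<open>J\<^sub>1\<close> and \<open>Z\<^sub>0\<close> is its component of type (0,1) for \<open>J\<^sub>0\<close>, then
  \<open>\<psi>(Z\<^sub>0) = \<psi>(Z\<^sub>1)\<close> and \<open>\<phi>(Z\<^sub>0) = 0\<close>, so that \<open>Z(s) = (1 - s) Z\<^sub>0 + s Z\<^sub>1\<close> satisfies this equation for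
  every \<open>s\<close> (\<open>type01_curve\<close>). The component map is bijective between the two spaces
  (\<open>surj_average_vec\<close>), so that these curves sweep out all (0,1)-vectors both for \<open>s = 0\<close> and for \<open>s = 1\<close>.

  The fibrewise map underlying the rank is defined through extensions of covectors to forms. That
  it is well defined follows by differentiating \<open>\<alpha>(J W) = \<i> \<alpha>(W)\<close>: the derivatives of \<open>\<alpha>\<close>
  cancel from the (0,2)-part of \<open>d\<alpha>\<close> (\<open>mubar_eq_symbol\<close>).
\<close>

section \<open>Independent families of complex-valued functions\<close>

text \<open>The index matters: members that become equal for a special parameter count as dependent,
  while the set of values would merely lose an element.\<close>

definition independent_family :: "'j set \<Rightarrow> ('j \<Rightarrow> 'i \<Rightarrow> complex) \<Rightarrow> bool" where
  "independent_family S h \<longleftrightarrow> (\<forall>a. (\<forall>i. (\<Sum>j\<in>S. a j * h j i) = 0) \<longrightarrow> (\<forall>j\<in>S. a j = 0))"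

lemma independent_familyD:
  assumes "independent_family S h" "\<And>i. (\<Sum>j\<in>S. a j * h j i) = 0" "j \<in> S"
  shows "a j = 0"
  using assms unfolding independent_family_def by simp

lemma independent_familyI:
  assumes "\<And>a j. (\<And>i. (\<Sum>j\<in>S. a j * h j i) = 0) \<Longrightarrow> j \<in> S \<Longrightarrow> a j = 0"
  shows "independent_family S h"
  using assms unfolding independent_family_def by simp

lemma sum_fun_apply: "(\<Sum>j\<in>I. g j) i = (\<Sum>j\<in>I. g j i :: complex)"
  by (induction I rule: infinite_finite_induct) auto

lemma in_span_image_iff:
  assumes "finite I"
  shows "h \<in> cfun.span (g ` I) \<longleftrightarrow> (\<exists>a. h = (\<lambda>i. \<Sum>j\<in>I. a j * g j i))"
proof
  let ?T = "{h. \<exists>a. h = (\<lambda>i. \<Sum>j\<in>I. a j * g j i)}"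
  have "cfun.subspace ?T"
  proof (rule cfun.subspaceI)
    show "0 \<in> ?T" by (intro CollectI exI[of _ "\<lambda>_. 0"]) auto
    fix x y assume "x \<in> ?T" "y \<in> ?T"
    then obtain a b where "x = (\<lambda>i. \<Sum>j\<in>I. a j * g j i)" "y = (\<lambda>i. \<Sum>j\<in>I. b j * g j i)"
      by blast
    then show "x + y \<in> ?T"
      by (intro CollectI exI[of _ "\<lambda>j. a j + b j"]) (auto simp: sum.distrib algebra_simps)
  next
    fix r x assume "x \<in> ?T"
    then obtain a where "x = (\<lambda>i. \<Sum>j\<in>I. a j * g j i)" by blast
    then show "(\<lambda>i. r * x i) \<in> ?T"
      by (intro CollectI exI[of _ "\<lambda>j. r * a j"]) (auto simp: sum_distrib_left algebra_simps)
  qed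
  moreover have "g ` I \<subseteq> ?T"
  proof
    fix h assume "h \<in> g ` I"
    then obtain k where "k \<in> I" "h = g k" by blast
    then show "h \<in> ?T"
      using assms by (intro CollectI exI[of _ "\<lambda>j. of_bool (j = k)"]) (auto simp: of_bool_def if_distrib if_distribR cong: if_cong)
  qed
  ultimately have "cfun.span (g ` I) \<subseteq> ?T" by (rule cfun.span_minimal[rotated])
  then show "\<exists>a. h = (\<lambda>i. \<Sum>j\<in>I. a j * g j i)" if "h \<in> cfun.span (g ` I)"
    using that by blast
next
  assume "\<exists>a. h = (\<lambda>i. \<Sum>j\<in>I. a j * g j i)"
  then obtain a where "h = (\<Sum>j\<in>I. (\<lambda>i. a j * g j i))" by (auto simp: sum_fun_apply fun_eq_iff)
  then show "h \<in> cfun.span (g ` I)"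
    by (simp only:) (intro cfun.span_sum cfun.span_scale; simp add: cfun.span_base)
qed

lemma independent_family_iff:
  assumes "finite S"
  shows "independent_family S h \<longleftrightarrow> inj_on h S \<and> cfun.independent (h ` S)"
proof
  assume h: "independent_family S h"
  have inj: "inj_on h S"
  proof (rule inj_onI, rule ccontr)
    fix k l assume kl: "k \<in> S" "l \<in> S" "h k = h l" "k \<noteq> l"
    define a :: "'a \<Rightarrow> complex" where "a j = (if j = k then 1 else 0) - (if j = l then 1 else 0)" for j
    have "(\<Sum>j\<in>S. a j * h j i) = 0" for i
      using kl(1,2) assms fun_cong[OF kl(3), of i]
      by (simp add: a_def left_diff_distrib sum_subtractf mult_delta_left)
    from independent_familyD[OF h this kl(1)] show False using kl(4) by (simp add: a_def)
  qed
  moreover have "cfun.independent (h ` S)"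
  proof (rule cfun.independent_if_scalars_zero)
    fix a x assume a: "(\<Sum>x\<in>h ` S. (\<lambda>i. a x * x i)) = 0" and "x \<in> h ` S"
    then obtain j where j: "j \<in> S" "x = h j" by blast
    have "(\<Sum>j\<in>S. a (h j) * h j i) = 0" for i
      using fun_cong[OF a, of i] by (simp add: sum.reindex[OF inj] sum_fun_apply)
    from independent_familyD[OF h this j(1)] show "a x = 0" using j(2) by simp
  qed (use assms in simp)
  ultimately show "inj_on h S \<and> cfun.independent (h ` S)" by blast
next
  assume h: "inj_on h S \<and> cfun.independent (h ` S)"
  show "independent_family S h"
  proof (rule independent_familyI)
    fix a j assume a: "\<And>i. (\<Sum>j\<in>S. a j * h j i) = 0" and j: "j \<in> S"
    define b where "b x = a (inv_into S h x)" for x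
    have b: "b (h j) = a j" if "j \<in> S" for j
      using h that by (simp add: b_def)
    have "(\<Sum>x\<in>h ` S. (\<lambda>i. b x * x i)) = 0"
      using a h b by (simp add: sum.reindex sum_fun_apply fun_eq_iff)
    then have "b (h j) = 0"
      using h assms j cfun.independentD[of "h ` S" "h ` S" b "h j"] by blast
    then show "a j = 0" using b[OF j] by simp
  qed
qed

lemma card_le_dim_image:
  assumes "finite I" "S \<subseteq> I" "independent_family S h"
  shows "card S \<le> cfun.dim (h ` I)"
proof -
  obtain B where B: "B \<subseteq> h ` I" "h ` I \<subseteq> cfun.span B" "card B = cfun.dim (h ` I)"
    using cfun.basis_exists by metis
  have "finite S" using assms finite_subset by blast
  then have S: "inj_on h S" "cfun.independent (h ` S)"
    using assms(3) independent_family_iff by blast+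
  have "card (h ` S) \<le> card B"
    using cfun.independent_span_bound[of B "h ` S"] S(2) B(1,2) assms(1,2)
    by (meson finite_imageI finite_subset image_mono order_trans)
  then show ?thesis using B(3) by (simp add: card_image[OF S(1)])
qed

lemma obtain_independent_subfamily:
  assumes "finite I"
  obtains S where "S \<subseteq> I" "independent_family S h" "card S = cfun.dim (h ` I)"
proof -
  obtain B where B: "B \<subseteq> h ` I" "cfun.independent B" "card B = cfun.dim (h ` I)"
    using cfun.basis_exists by metis
  then obtain S where S: "S \<subseteq> I" "inj_on h S" "B = h ` S"
    unfolding subset_image_inj by blast
  moreover have "finite S" using S(1) assms finite_subset by blast
  ultimately show ?thesis
    using that[of S] B by (simp add: independent_family_iff card_image)
qed

section \<open>Independence of families that depend polynomially on a parameter\<close>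

definition polyfun :: "(complex \<Rightarrow> complex) \<Rightarrow> bool" where
  "polyfun g \<longleftrightarrow> (\<exists>p. g = poly p)"

lemma polyfun_const: "polyfun (\<lambda>s. a)"
  unfolding polyfun_def by (intro exI[of _ "[:a:]"]) auto

lemma polyfun_ident: "polyfun (\<lambda>s. s)"
  unfolding polyfun_def by (intro exI[of _ "[:0, 1:]"]) auto

lemma polyfun_add: "polyfun g \<Longrightarrow> polyfun h \<Longrightarrow> polyfun (\<lambda>s. g s + h s)"
  unfolding polyfun_def by (auto simp flip: poly_add)

lemma polyfun_diff: "polyfun g \<Longrightarrow> polyfun h \<Longrightarrow> polyfun (\<lambda>s. g s - h s)"
  unfolding polyfun_def by (auto simp flip: poly_diff)

lemma polyfun_mult: "polyfun g \<Longrightarrow> polyfun h \<Longrightarrow> polyfun (\<lambda>s. g s * h s)"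
  unfolding polyfun_def by (auto simp flip: poly_mult)

lemmas polyfun_intros = polyfun_const polyfun_ident polyfun_add polyfun_diff polyfun_mult

lemma finite_zeros_polyfun:
  assumes "polyfun g" "g s0 \<noteq> 0" shows "finite {s. g s = 0}"
proof -
  obtain p where p: "g = poly p" using assms(1) unfolding polyfun_def by blast
  then have "p \<noteq> 0" using assms(2) by auto
  then show ?thesis unfolding p by (rule poly_roots_finite)
qed

text \<open>One step of Gauss elimination, carried out simultaneously for all parameters. An argument \<open>i\<close> at
  which the new member \<open>v s0 k\<close> does not vanish serves as pivot. Cross-multiplication with the
  pivot entry instead of division keeps the entries polynomial, and the eliminated family is
  equivalent to the original one except at the finitely many zeros of the pivot entry.\<close>

lemma finite_dependent_parameters:
  fixes v :: "complex \<Rightarrow> 'j \<Rightarrow> 'i \<Rightarrow> complex"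
  assumes "finite S" and "\<And>j i. j \<in> S \<Longrightarrow> polyfun (\<lambda>s. v s j i)"
    and "independent_family S (v s0)"
  shows "finite {s. \<not> independent_family S (v s)}"
  using assms
proof (induction S arbitrary: v rule: finite_induct)
  case empty
  then show ?case by (simp add: independent_family_def)
next
  case (insert k S)
  have "\<exists>i. v s0 k i \<noteq> 0"
  proof (rule ccontr)
    assume "\<nexists>i. v s0 k i \<noteq> 0"
    then have "(\<Sum>j\<in>insert k S. of_bool (j = k) * v s0 j i) = 0" for i
      by (auto intro!: sum.neutral)
    from independent_familyD[OF insert.prems(2) this, of k] show False by simp
  qed
  then obtain i where i: "v s0 k i \<noteq> 0" by blast
  define w where "w s j l = v s k i * v s j l - v s j i * v s k l" for s j l
  have elim: "(\<Sum>j\<in>S. a j * w s j l) =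
      v s k i * (\<Sum>j\<in>S. a j * v s j l) - (\<Sum>j\<in>S. a j * v s j i) * v s k l" for s a l
    by (simp add: w_def algebra_simps sum_subtractf sum_distrib_left sum_distrib_right)
  have "independent_family S (w s0)"
  proof (rule independent_familyI)
    fix a j assume a: "\<And>l. (\<Sum>j\<in>S. a j * w s0 j l) = 0" and j: "j \<in> S"
    \<comment> \<open>A relation among the eliminated functions, rewritten for the original ones.\<close>
    define b where "b j = (if j = k then - (\<Sum>j\<in>S. a j * v s0 j i) else v s0 k i * a j)" for j
    have "(\<Sum>j\<in>S. b j * v s0 j l) = v s0 k i * (\<Sum>j\<in>S. a j * v s0 j l)" for l
      unfolding sum_distrib_left b_def using insert.hyps by (intro sum.cong) auto
    then have "(\<Sum>j\<in>insert k S. b j * v s0 j l) = 0" for l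
      using a[of l] insert.hyps by (simp add: elim b_def)
    from independent_familyD[OF insert.prems(2) this, of j] show "a j = 0"
      using i j insert.hyps by (auto simp: b_def split: if_splits)
  qed
  moreover have "polyfun (\<lambda>s. w s j l)" if "j \<in> S" for j l
    unfolding w_def using insert.prems(1) that by (intro polyfun_intros) auto
  ultimately have "finite {s. \<not> independent_family S (w s)}"
    using insert.IH by blast
  moreover have "finite {s. v s k i = 0}"
    using insert.prems(1) i by (intro finite_zeros_polyfun) auto
  moreover have "independent_family (insert k S) (v s)"
    if s: "independent_family S (w s)" "v s k i \<noteq> 0" for s
  proof (rule independent_familyI)
    fix a j assume a: "\<And>l. (\<Sum>j\<in>insert k S. a j * v s j l) = 0" and j: "j \<in> insert k S"
    have *: "(\<Sum>j\<in>S. a j * v s j l) = - a k * v s k l" for l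
      using a[of l] insert.hyps by (simp add: eq_neg_iff_add_eq_0 add.commute)
    have "(\<Sum>j\<in>S. a j * w s j l) = 0" for l
      unfolding elim * by simp
    from independent_familyD[OF s(1) this] have S: "a l = 0" if "l \<in> S" for l
      using that .
    then have "a k = 0" using *[of i] s(2) by simp
    with S j show "a j = 0" by auto
  qed
  then have "{s. \<not> independent_family (insert k S) (v s)}
      \<subseteq> {s. \<not> independent_family S (w s)} \<union> {s. v s k i = 0}"
    by blast
  ultimately show ?case
    by (meson finite_UnI finite_subset)
qed

section \<open>Complexified vectors and the pencil of co-frames\<close>

text \<open>A pair \<open>(v, v')\<close> stands for the complexified vector \<open>v + \<i> v'\<close>. The following three constants
  are multiplication by a complex number and the complex linear and bilinear extensions of
  real-linear data.\<close>

definition cscale :: "complex \<Rightarrow> 'e::real_vector \<times> 'e \<Rightarrow> 'e \<times> 'e" where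
  "cscale a Z = (Re a *\<^sub>R fst Z - Im a *\<^sub>R snd Z, Re a *\<^sub>R snd Z + Im a *\<^sub>R fst Z)"

definition clin :: "('e \<Rightarrow> complex) \<Rightarrow> 'e \<times> 'e \<Rightarrow> complex" where
  "clin h Z = h (fst Z) + \<i> * h (snd Z)"

definition cbil :: "('e \<Rightarrow> 'e \<Rightarrow> complex) \<Rightarrow> 'e \<times> 'e \<Rightarrow> 'e \<times> 'e \<Rightarrow> complex" where
  "cbil b Z W = clin (\<lambda>v. clin (b v) W) Z"

lemma clin_add: "linear h \<Longrightarrow> clin h (Z + W) = clin h Z + clin h W"
  by (simp add: clin_def linear_add algebra_simps)

lemma clin_cscale:
  assumes "linear h" shows "clin h (cscale a Z) = a * clin h Z"
proof -
  have "h (fst (cscale a Z)) = of_real (Re a) * h (fst Z) - of_real (Im a) * h (snd Z)"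
    "h (snd (cscale a Z)) = of_real (Re a) * h (snd Z) + of_real (Im a) * h (fst Z)"
    using assms by (simp_all add: cscale_def linear_add linear_diff linear_scale scaleR_conv_of_real)
  then have "clin h (cscale a Z) = (of_real (Re a) + \<i> * of_real (Im a)) * clin h Z"
    by (simp add: clin_def algebra_simps)
  then show ?thesis by (simp flip: complex_eq)
qed

lemma linear_clin_left:
  assumes "\<And>w. linear (\<lambda>v. b v w)" shows "linear (\<lambda>v. clin (b v) W)"
  using linear_add[OF assms] linear_scale[OF assms]
  by (intro linearI) (simp_all add: clin_def algebra_simps)

definition bilinear_form :: "('e::real_vector \<Rightarrow> 'e \<Rightarrow> complex) \<Rightarrow> bool" where
  "bilinear_form b \<longleftrightarrow> (\<forall>w. linear (\<lambda>v. b v w)) \<and> (\<forall>v. linear (b v))"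

lemma cbil_expand:
  assumes "bilinear_form b"
  shows "cbil b (cscale a Z + cscale a' Z') (cscale a W + cscale a' W') =
    a * a * cbil b Z W + a * a' * cbil b Z W' + a' * a * cbil b Z' W + a' * a' * cbil b Z' W'"
proof -
  have l: "linear (\<lambda>v. clin (b v) W)" for W
    using assms by (intro linear_clin_left) (simp add: bilinear_form_def)
  have r: "linear (b v)" for v using assms by (simp add: bilinear_form_def)
  have *: "cbil b (cscale a Z + cscale a' Z') W = a * cbil b Z W + a' * cbil b Z' W" for W
    using l by (simp add: cbil_def clin_add clin_cscale)
  have "cbil b Z (cscale a W + cscale a' W') = a * cbil b Z W + a' * cbil b Z W'" for Z
    unfolding cbil_def using r
    by (simp add: clin_add clin_cscale) (simp add: clin_def algebra_simps)
  then show ?thesis by (simp add: * algebra_simps)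
qed

text \<open>The vector \<open>v + \<i> J v\<close>; for a complex structure \<open>J\<close> these are exactly the vectors of type (0,1),
  and \<open>v\<close> is recovered as the real part.\<close>

definition graph_vec :: "('e \<Rightarrow> 'e) \<Rightarrow> 'e \<Rightarrow> 'e \<times> 'e" where
  "graph_vec J v = (v, J v)"

text \<open>Four times the projection of \<open>b\<close> onto its part of type (0,2), since
  \<open>v + \<i> J v\<close> is twice the (0,1)-component of \<open>v\<close>.\<close>

definition type02_part :: "('e \<Rightarrow> 'e \<Rightarrow> complex) \<Rightarrow> ('e \<Rightarrow> 'e) \<Rightarrow> 'e \<times> 'e \<Rightarrow> complex" where
  "type02_part b J = (\<lambda>(v, w). cbil b (graph_vec J v) (graph_vec J w))"

text \<open>If \<open>\<omega>(v) + \<i> \<omega>(v') = 0\<close>, then \<open>\<omega>(J v) = \<i> \<omega>(v) = \<omega>(v')\<close>, hence \<open>v' = J v\<close>. So the vectors of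
  type (0,1) are recognized as common zeros of the (1,0)-forms.\<close>

lemma clin_eq_0_imp_graph:
  assumes lin: "\<And>j. j \<in> I \<Longrightarrow> linear (\<omega> j)"
    and J: "\<And>j v. j \<in> I \<Longrightarrow> \<omega> j (J v) = \<i> * \<omega> j v"
    and sep: "\<And>v. (\<And>j. j \<in> I \<Longrightarrow> \<omega> j v = 0) \<Longrightarrow> v = 0"
    and Z: "\<And>j. j \<in> I \<Longrightarrow> clin (\<omega> j) Z = 0"
  shows "Z = graph_vec J (fst Z)"
proof -
  have "\<omega> j (J (fst Z) - snd Z) = 0" if "j \<in> I" for j
  proof -
    have "\<omega> j (J (fst Z) - snd Z) = \<i> * clin (\<omega> j) Z"
      using lin[OF that] J[OF that] by (simp add: linear_diff clin_def algebra_simps)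
    then show ?thesis using Z[OF that] by simp
  qed
  then have "J (fst Z) - snd Z = 0" by (rule sep)
  then show ?thesis by (simp add: graph_vec_def prod_eq_iff)
qed

lemma clin_graph_vec: "h (J v) = \<i> * h v \<Longrightarrow> clin h (graph_vec J v) = 0"
  by (simp add: clin_def graph_vec_def)

text \<open>The real part of the component of \<open>v + \<i> J1 v\<close> that is of type (0,1) for \<open>J0\<close>, obtained by applying
  \<open>(1 + \<i> J0) / 2\<close>.\<close>

definition average_vec :: "('e \<Rightarrow> 'e) \<Rightarrow> ('e \<Rightarrow> 'e) \<Rightarrow> 'e \<Rightarrow> 'e::real_vector" where
  "average_vec J0 J1 v = (1/2) *\<^sub>R (v - J0 (J1 v))"

text \<open>The segment, with complex parameter, from the \<open>J0\<close>-component of type (0,1) of \<open>v + \<i> J1 v\<close> to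
  \<open>v + \<i> J1 v\<close> itself.\<close>

definition type01_curve ::
   "('e \<Rightarrow> 'e) \<Rightarrow> ('e \<Rightarrow> 'e) \<Rightarrow> complex \<Rightarrow> 'e \<Rightarrow> 'e \<times> 'e::real_vector" where
  "type01_curve J0 J1 s v =
     cscale (1 - s) (graph_vec J0 (average_vec J0 J1 v)) + cscale s (graph_vec J1 v)"

text \<open>The data at one point, read in a chart: \<open>\<omega> s\<close> is the deformed co-frame. The
  structures at the parameters 0 and 1 span the curves of (0,1)-vectors; those at other parameters
  enter through \<open>structure_at\<close> below.\<close>

locale coframe_pencil =
  fixes I :: "'j set" and \<phi> :: "'j \<Rightarrow> 'e::euclidean_space \<Rightarrow> complex"
    and F :: "'j \<Rightarrow> 'j \<Rightarrow> complex" and J0 J1 :: "'e \<Rightarrow> 'e"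
    and \<omega> :: "complex \<Rightarrow> 'j \<Rightarrow> 'e \<Rightarrow> complex"
  defines "\<omega> \<equiv> \<lambda>s j v. \<phi> j v + s * (\<Sum>k\<in>I. F j k * cnj (\<phi> k v))"
  assumes lin: "\<And>j. j \<in> I \<Longrightarrow> linear (\<phi> j)"
    and J0_J0: "\<And>v. J0 (J0 v) = - v"
    and linear_J0: "linear J0" and linear_J1: "linear J1"
    and J0: "\<And>j v. j \<in> I \<Longrightarrow> \<phi> j (J0 v) = \<i> * \<phi> j v"
    and J1: "\<And>j v. j \<in> I \<Longrightarrow> \<omega> 1 j (J1 v) = \<i> * \<omega> 1 j v"
    and sep: "\<And>v. (\<And>j. j \<in> I \<Longrightarrow> \<phi> j v = 0) \<Longrightarrow> v = 0"
begin

lemma linear_\<omega>: "j \<in> I \<Longrightarrow> linear (\<omega> s j)"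
  using lin unfolding \<omega>_def
  by (intro linearI)
     (simp_all add: linear_add linear_scale algebra_simps sum.distrib sum_distrib_left scaleR_conv_of_real)

lemma linear_average_vec: "linear (average_vec J0 J1)"
  by (intro linearI)
     (simp_all add: average_vec_def linear_add[OF linear_J0] linear_add[OF linear_J1]
       linear_scale[OF linear_J0] linear_scale[OF linear_J1] algebra_simps)

text \<open>If \<open>v + \<i> J1 v\<close> has no \<open>J0\<close>-component of type (0,1), then the conjugates of the \<open>\<phi>\<^sup>k\<close>
  vanish on it. Hence so do the \<open>\<phi>\<^sup>j\<close>, because \<open>\<omega>\<^sub>1\<close> does, and \<open>v = 0\<close>. Surjectivity
  follows as the dimension is finite.\<close>

lemma surj_average_vec: "surj (average_vec J0 J1)"
proof (rule linear_inj_imp_surj[OF linear_average_vec])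
  have "v = 0" if "average_vec J0 J1 v = 0" for v
  proof (rule sep)
    fix j assume j: "j \<in> I"
    have "J0 (J1 v) = v" using that by (simp add: average_vec_def)
    then have "J1 v = - J0 v" using J0_J0[of "J1 v"] by simp
    then have \<phi>: "\<phi> k (J1 v) = - \<i> * \<phi> k v" if "k \<in> I" for k
      using J0[OF that, of v] linear_neg[OF lin[OF that], of "J0 v"] by simp
    have "- \<i> * \<phi> j v + (\<Sum>k\<in>I. F j k * cnj (- \<i> * \<phi> k v)) =
        \<i> * (\<phi> j v + (\<Sum>k\<in>I. F j k * cnj (\<phi> k v)))"
      using J1[OF j, of v] \<phi> j by (simp add: \<omega>_def)
    then show "\<phi> j v = 0"
      by (simp add: algebra_simps sum_distrib_left)
  qed
  then show "inj (average_vec J0 J1)"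
    using linear_injective_0[OF linear_average_vec] by blast
qed

text \<open>Both end points of the segment have the same values under the conjugates of the \<open>\<phi>\<^sup>k\<close>, so
  that these values are constant along it, while the values under \<open>\<phi>\<^sup>j\<close> grow linearly in \<open>s\<close>
  from 0. Hence the condition \<open>\<phi>\<^sup>j = - s \<Sum>\<^sub>k F\<^sup>j\<^sub>k \<phi>\<^sup>k\<^sup>*\<close>, where \<open>\<phi>\<^sup>k\<^sup>*\<close> is the conjugate of
  \<open>\<phi>\<^sup>k\<close>, holds for all \<open>s\<close> as soon as it holds for \<open>s = 1\<close>.\<close>

lemma type01_curve:
  assumes j: "j \<in> I" shows "clin (\<omega> s j) (type01_curve J0 J1 s v) = 0"
proof -
  define u where "u = average_vec J0 J1 v"
  have u0: "clin (\<phi> k) (graph_vec J0 u) = 0" if "k \<in> I" for k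
    using J0[OF that] by (rule clin_graph_vec)
  have conj: "cnj (\<phi> k u) + \<i> * cnj (\<phi> k (J0 u)) = cnj (\<phi> k v) + \<i> * cnj (\<phi> k (J1 v))"
    if "k \<in> I" for k
    using J0[OF that] lin[OF that]
    by (simp add: u_def average_vec_def linear_diff linear_scale J0 scaleR_conv_of_real field_simps)
  define N where "N Z = (\<Sum>k\<in>I. F j k * (cnj (\<phi> k (fst Z)) + \<i> * cnj (\<phi> k (snd Z))))" for Z
  have clin: "clin (\<omega> s j) Z = clin (\<phi> j) Z + s * N Z" for s Z
    by (simp add: N_def clin_def \<omega>_def algebra_simps sum.distrib sum_distrib_left)
  have N: "N (graph_vec J0 u) = N (graph_vec J1 v)"
    unfolding N_def graph_vec_def using conj by (intro sum.cong) simp_all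
  have "clin (\<omega> 1 j) (graph_vec J1 v) = 0"
    using J1[OF j] by (rule clin_graph_vec)
  then have "clin (\<phi> j) (graph_vec J1 v) = - N (graph_vec J1 v)"
    by (simp add: clin eq_neg_iff_add_eq_0)
  then show ?thesis
    unfolding type01_curve_def u_def[symmetric]
      clin_add[OF linear_\<omega>[OF j]] clin_cscale[OF linear_\<omega>[OF j]]
    unfolding clin u0[OF j] N by (simp add: algebra_simps)
qed

lemma surj_fst_type01_curve:
  assumes "s = 0 \<or> s = 1"
  shows "surj (\<lambda>v. fst (type01_curve J0 J1 s v))"
proof -
  have "(\<lambda>v. fst (type01_curve J0 J1 0 v)) = average_vec J0 J1"
    "(\<lambda>v. fst (type01_curve J0 J1 1 v)) = id"
    by (auto simp: type01_curve_def cscale_def graph_vec_def)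
  with assms surj_average_vec show ?thesis by (elim disjE) (simp_all only: surj_id)
qed

text \<open>The pointwise content of \<open>\<omega> s\<close> being a co-frame of (1,0)-forms for \<open>K\<close>: a real vector on which
  all (1,0)-forms vanish is 0.\<close>

definition structure_at :: "complex \<Rightarrow> ('e \<Rightarrow> 'e) \<Rightarrow> bool" where
  "structure_at s K \<longleftrightarrow> (\<forall>j\<in>I. \<forall>v. \<omega> s j (K v) = \<i> * \<omega> s j v) \<and>
     (\<forall>v. (\<forall>j\<in>I. \<omega> s j v = 0) \<longrightarrow> v = 0)"

lemma type01_curve_eq_graph_vec:
  assumes "structure_at s K"
  shows "type01_curve J0 J1 s v = graph_vec K (fst (type01_curve J0 J1 s v))"
  using assms by (intro clin_eq_0_imp_graph[where \<omega> = "\<omega> s" and I = I])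
    (auto simp: structure_at_def linear_\<omega> type01_curve)

text \<open>On the curves of (0,1)-vectors the forms \<open>\<beta> s j\<close> take values that are polynomial in \<open>s\<close>, of
  degree at most 3. At \<open>s0\<close> these curves pass through all (0,1)-vectors, so that the
  assumed independence passes to the restrictions of the forms to the curves. Conversely, at
  any \<open>s\<close> independence on the curves implies independence on all (0,1)-vectors of a structure \<open>K\<close>
  at \<open>s\<close>.\<close>

lemma finite_dependent_type02_parts:
  assumes S: "finite S" "S \<subseteq> I"
    and b: "\<And>j. j \<in> S \<Longrightarrow> bilinear_form (b0 j)" "\<And>j. j \<in> S \<Longrightarrow> bilinear_form (b1 j)"
    and \<beta>: "\<And>s j. \<beta> s j = (\<lambda>v w. (1 - s) * b0 j v w + s * b1 j v w)"
    and s0: "s0 = 0 \<or> s0 = 1" and K0: "structure_at s0 K0"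
    and indep: "independent_family S (\<lambda>j. type02_part (\<beta> s0 j) K0)"
  shows "finite {s. \<exists>K. structure_at s K \<and> \<not> independent_family S (\<lambda>j. type02_part (\<beta> s j) K)}"
proof -
  define E where "E s j = (\<lambda>(v, w). cbil (\<beta> s j) (type01_curve J0 J1 s v) (type01_curve J0 J1 s w))"
    for s j
  let ?r = "\<lambda>s v. fst (type01_curve J0 J1 s v)"
  have E: "E s j (v, w) = type02_part (\<beta> s j) K (?r s v, ?r s w)"
    if "structure_at s K" for s j v w K
    using type01_curve_eq_graph_vec[OF that, of v] type01_curve_eq_graph_vec[OF that, of w]
    by (simp add: E_def type02_part_def)
  have "independent_family S (E s0)"
  proof (rule independent_familyI)
    fix a j assume a: "\<And>i. (\<Sum>j\<in>S. a j * E s0 j i) = 0" and j: "j \<in> S"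
    have "(\<Sum>j\<in>S. a j * type02_part (\<beta> s0 j) K0 (v, w)) = 0" for v w
    proof -
      obtain v' w' where "v = ?r s0 v'" "w = ?r s0 w'"
        using surj_fst_type01_curve[OF s0] unfolding surj_def by meson
      then show ?thesis using a[of "(v', w')"] E[OF K0] by simp
    qed
    then have "(\<Sum>j\<in>S. a j * type02_part (\<beta> s0 j) K0 i) = 0" for i
      by (cases i) blast
    from independent_familyD[OF indep this j] show "a j = 0" .
  qed
  moreover have "polyfun (\<lambda>s. E s j i)" if "j \<in> S" for j i
  proof -
    obtain v w where i: "i = (v, w)" by (cases i)
    have "bilinear_form (\<beta> s j)" for s
      using b[OF that] unfolding bilinear_form_def \<beta> linear_iff
      by (simp add: algebra_simps)
    note expand = cbil_expand[OF this]
    have "cbil (\<beta> s j) Z W = (1 - s) * cbil (b0 j) Z W + s * cbil (b1 j) Z W" for s Z W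
      by (simp add: \<beta> cbil_def clin_def algebra_simps)
    then show ?thesis
      unfolding i E_def type01_curve_def prod.case expand
      by (simp only:) (intro polyfun_intros)
  qed
  ultimately have "finite {s. \<not> independent_family S (E s)}"
    by (intro finite_dependent_parameters[OF S(1)])
  moreover have "independent_family S (\<lambda>j. type02_part (\<beta> s j) K)"
    if "structure_at s K" "independent_family S (E s)" for s K
  proof (rule independent_familyI)
    fix a j assume a: "\<And>i. (\<Sum>j\<in>S. a j * type02_part (\<beta> s j) K i) = 0" and j: "j \<in> S"
    have "(\<Sum>j\<in>S. a j * E s j i) = 0" for i
      using a by (cases i) (simp only: E[OF that(1)])
    from independent_familyD[OF that(2) this j] show "a j = 0" .
  qed
  then have "{s. \<exists>K. structure_at s K \<and> \<not> independent_family S (\<lambda>j. type02_part (\<beta> s j) K)}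
      \<subseteq> {s. \<not> independent_family S (E s)}"
    by blast
  ultimately show ?thesis by (rule finite_subset[rotated])
qed

end

section \<open>Smooth functions\<close>

lemma Ck_on_cong:
  assumes "open S" "\<And>y. y \<in> S \<Longrightarrow> f y = g y" "Ck_on k S f"
  shows "Ck_on k S g"
  using assms(2,3)
proof (induction k arbitrary: f g)
  case 0
  then show ?case using continuous_on_cong[of S S f g] by simp
next
  case (Suc k)
  have D: "(g has_derivative frechet_derivative f (at y)) (at y)" if "y \<in> S" for y
  proof (rule has_derivative_transform_within_open[OF _ assms(1) that])
    show "(f has_derivative frechet_derivative f (at y)) (at y)"
      using Suc.prems(2) that by (simp flip: frechet_derivative_works)
  qed (use Suc.prems(1) in simp)
  have "Ck_on k S (\<lambda>y. frechet_derivative g (at y) v)" for v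
  proof (rule Suc.IH)
    show "Ck_on k S (\<lambda>y. frechet_derivative f (at y) v)" using Suc.prems(2) by simp
  qed (use frechet_derivative_at[OF D] in simp)
  moreover have "g differentiable (at y)" if "y \<in> S" for y
    using D[OF that] by (auto simp: differentiable_def)
  ultimately show ?case by simp
qed

lemma has_derivative_linear_combination:
  fixes f :: "'j \<Rightarrow> 'e::real_normed_vector \<Rightarrow> complex"
  assumes "\<And>j. j \<in> I \<Longrightarrow> f j differentiable (at y)"
  shows "((\<lambda>y. \<Sum>j\<in>I. a j * f j y) has_derivative
    (\<lambda>v. \<Sum>j\<in>I. a j * frechet_derivative (f j) (at y) v)) (at y)"
  using assms
  by (intro has_derivative_sum has_derivative_mult_right) (simp flip: frechet_derivative_works)

lemma Ck_on_linear_combination: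
  fixes f :: "'j \<Rightarrow> 'e::euclidean_space \<Rightarrow> complex"
  assumes "open S" "\<And>j. j \<in> I \<Longrightarrow> Ck_on k S (f j)"
  shows "Ck_on k S (\<lambda>y. \<Sum>j\<in>I. a j * f j y)"
  using assms(2)
proof (induction k arbitrary: f)
  case 0
  then show ?case by (auto intro!: continuous_intros)
next
  case (Suc k)
  have D: "((\<lambda>y. \<Sum>j\<in>I. a j * f j y) has_derivative
      (\<lambda>v. \<Sum>j\<in>I. a j * frechet_derivative (f j) (at y) v)) (at y)" if "y \<in> S" for y
    using Suc.prems that by (intro has_derivative_linear_combination) simp
  have "Ck_on k S (\<lambda>y. frechet_derivative (\<lambda>y. \<Sum>j\<in>I. a j * f j y) (at y) v)" for v
  proof (rule Ck_on_cong[OF assms(1)])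
    show "Ck_on k S (\<lambda>y. \<Sum>j\<in>I. a j * frechet_derivative (f j) (at y) v)"
      using Suc.prems by (intro Suc.IH) simp
    show "(\<Sum>j\<in>I. a j * frechet_derivative (f j) (at y) v) =
        frechet_derivative (\<lambda>y. \<Sum>j\<in>I. a j * f j y) (at y) v" if "y \<in> S" for y
      by (rule fun_cong[OF frechet_derivative_at[OF D[OF that]]])
  qed
  moreover have "(\<lambda>y. \<Sum>j\<in>I. a j * f j y) differentiable (at y)" if "y \<in> S" for y
    using D[OF that] by (auto simp: differentiable_def)
  ultimately show ?case by simp
qed

lemma linear_eq_sum_Basis:
  fixes h :: "'e::euclidean_space \<Rightarrow> complex"
  assumes "linear h"
  shows "h u = (\<Sum>b\<in>Basis. complex_of_real (u \<bullet> b) * h b)"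
proof -
  have "h u = h (\<Sum>b\<in>Basis. (u \<bullet> b) *\<^sub>R b)" by (simp add: euclidean_representation)
  also have "\<dots> = (\<Sum>b\<in>Basis. (u \<bullet> b) *\<^sub>R h b)"
    using assms by (simp add: linear_sum linear_scale)
  finally show ?thesis by (simp add: scaleR_conv_of_real)
qed

section \<open>Tangent vectors and almost complex structures in a chart\<close>

text \<open>In a fixed chart the tangent spaces at all points of its domain are identified with the model
  space \<open>'e\<close> by \<open>coord_vec A c x\<close>, whose inverse evaluates a tangent vector at \<open>c\<close>.\<close>

locale manifold_chart =
  fixes X :: "'a topology" and A :: "('a, 'e::euclidean_space) chart set" and c :: "('a, 'e) chart"
  assumes manifold: "smooth_manifold X A" and chart: "c \<in> A"
begin

lemma chart_inv_left: "x \<in> fst c \<Longrightarrow> chart_inv c (snd c x) = x"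
proof -
  assume x: "x \<in> fst c"
  have "openin X (fst c)" "homeomorphic_map (subtopology X (fst c)) (top_of_set (chart_image c)) (snd c)"
    using manifold chart by (auto simp: smooth_manifold_def)
  then have "inj_on (snd c) (fst c)"
    using homeomorphic_imp_injective_map[of "subtopology X (fst c)"] openin_subset[of X "fst c"]
    by (metis topspace_subtopology_subset)
  then show ?thesis using x by (simp add: chart_inv_def)
qed

lemma open_chart_image: "open (chart_image c)"
  using manifold chart by (auto simp: smooth_manifold_def)

lemma open_image_Int:
  assumes "openin X U" shows "open (snd c ` (fst c \<inter> U))"
proof -
  have o: "openin X (fst c)" "homeomorphic_map (subtopology X (fst c)) (top_of_set (chart_image c)) (snd c)"
    using manifold chart by (auto simp: smooth_manifold_def)
  have "open_map (subtopology X (fst c)) (top_of_set (chart_image c)) (snd c)"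
    using o(2) homeomorphic_imp_open_map by blast
  moreover have "openin (subtopology X (fst c)) (fst c \<inter> U)"
    using assms by (auto simp: openin_subtopology)
  ultimately have "openin (top_of_set (chart_image c)) (snd c ` (fst c \<inter> U))"
    by (auto simp: open_map_def)
  then show ?thesis using open_chart_image openin_open_trans by blast
qed

lemma transition_has_derivative:
  assumes "x \<in> fst c" "c' \<in> A" "x \<in> fst c'"
  shows "(snd c' \<circ> chart_inv c has_derivative transition_deriv c c' x) (at (snd c x))"
proof -
  have "smooth_on (snd c ` (fst c \<inter> fst c')) (snd c' \<circ> chart_inv c)"
    using manifold chart assms by (auto simp: smooth_manifold_def)
  then have "Ck_on (Suc 0) (snd c ` (fst c \<inter> fst c')) (snd c' \<circ> chart_inv c)"
    unfolding smooth_on_def by blast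
  then have "(snd c' \<circ> chart_inv c) differentiable (at (snd c x))"
    using assms by auto
  then show ?thesis
    unfolding transition_deriv_def by (simp add: frechet_derivative_works)
qed

lemma linear_transition_deriv:
  "\<lbrakk>x \<in> fst c; c' \<in> A; x \<in> fst c'\<rbrakk> \<Longrightarrow> linear (transition_deriv c c' x)"
  using transition_has_derivative has_derivative_linear by blast

lemma transition_deriv_self:
  assumes "x \<in> fst c" shows "transition_deriv c c x v = v"
proof -
  have "(snd c \<circ> chart_inv c has_derivative (\<lambda>v. v)) (at (snd c x))"
  proof (rule has_derivative_transform_within_open[where s = "chart_image c"])
    show "((\<lambda>v. v) has_derivative (\<lambda>v. v)) (at (snd c x))" by simp
    show "y = (snd c \<circ> chart_inv c) y" if "y \<in> chart_image c" for y
      using that by (auto simp: chart_image_def chart_inv_left)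
  qed (use assms open_chart_image in \<open>auto simp: chart_image_def\<close>)
  from frechet_derivative_at[OF this] show ?thesis
    unfolding transition_deriv_def by metis
qed

lemma transition_deriv_cocycle:
  assumes x: "x \<in> fst c" and c1: "c1 \<in> A" "x \<in> fst c1" and c2: "c2 \<in> A" "x \<in> fst c2"
  shows "transition_deriv c c2 x v = transition_deriv c1 c2 x (transition_deriv c c1 x v)"
proof -
  interpret c1: manifold_chart X A c1 using manifold c1 by unfold_locales
  have o: "openin X (fst c1)" "openin X (fst c2)"
    using manifold c1 c2 by (auto simp: smooth_manifold_def)
  have "(snd c1 \<circ> chart_inv c) (snd c x) = snd c1 x"
    using x by (simp add: chart_inv_left)
  then have "((snd c2 \<circ> chart_inv c1) \<circ> (snd c1 \<circ> chart_inv c) has_derivative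
      transition_deriv c1 c2 x \<circ> transition_deriv c c1 x) (at (snd c x))"
    using transition_has_derivative[OF x c1] c1.transition_has_derivative[OF c1(2) c2]
    by (intro diff_chain_at) simp_all
  then have "(snd c2 \<circ> chart_inv c has_derivative
      transition_deriv c1 c2 x \<circ> transition_deriv c c1 x) (at (snd c x))"
    by (rule has_derivative_transform_within_open
          [OF _ open_image_Int[OF openin_Int[OF o]]])
      (use x c1 c2 in \<open>auto simp: chart_inv_left c1.chart_inv_left\<close>)
  from frechet_derivative_at[OF this] show ?thesis
    unfolding transition_deriv_def[of c c2] by (metis comp_apply)
qed

lemma coord_vec_in_tangent_space:
  assumes "x \<in> fst c" shows "coord_vec A c x v \<in> tangent_space A x"
  unfolding tangent_space_def
proof (intro CollectI conjI ballI allI impI)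
  fix c1 c2 assume c12: "c1 \<in> charts_at A x" "c2 \<in> charts_at A x"
  then have "transition_deriv c c2 x v = transition_deriv c1 c2 x (transition_deriv c c1 x v)"
    using assms by (intro transition_deriv_cocycle) (auto simp: charts_at_def)
  then show "coord_vec A c x v c2 = transition_deriv c1 c2 x (coord_vec A c x v c1)"
    using c12 by (simp add: coord_vec_def)
qed (simp add: coord_vec_def)

lemma coord_vec_self: "x \<in> fst c \<Longrightarrow> coord_vec A c x v c = v"
  using chart by (simp add: coord_vec_def charts_at_def transition_deriv_self)

lemma coord_vec_of_tangent:
  assumes x: "x \<in> fst c" and \<xi>: "\<xi> \<in> tangent_space A x"
  shows "coord_vec A c x (\<xi> c) = \<xi>"
proof
  fix c' show "coord_vec A c x (\<xi> c) c' = \<xi> c'"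
  proof (cases "c' \<in> charts_at A x")
    case True
    moreover have "c \<in> charts_at A x" using chart x by (simp add: charts_at_def)
    ultimately have "\<xi> c' = transition_deriv c c' x (\<xi> c)"
      using \<xi> unfolding tangent_space_def by blast
    then show ?thesis using True by (simp only: coord_vec_def if_True)
  next
    case False
    moreover from this have "\<xi> c' = 0" using \<xi> unfolding tangent_space_def by blast
    ultimately show ?thesis by (simp only: coord_vec_def if_False)
  qed
qed

lemma coord_vec_add:
  "x \<in> fst c \<Longrightarrow> coord_vec A c x (v + w) = coord_vec A c x v + coord_vec A c x w"
  using linear_transition_deriv
  by (auto simp: coord_vec_def charts_at_def fun_eq_iff linear_add)

lemma coord_vec_scaleR:
  "x \<in> fst c \<Longrightarrow> coord_vec A c x (r *\<^sub>R v) = tscale r (coord_vec A c x v)"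
  using linear_transition_deriv
  by (auto simp: coord_vec_def charts_at_def tscale_def fun_eq_iff linear_scale)

lemma linear_covector:
  assumes "a \<in> covectors A x" "x \<in> fst c"
  shows "linear (\<lambda>v. a (coord_vec A c x v))"
  using assms coord_vec_in_tangent_space
  by (auto simp: linear_iff covectors_def coord_vec_add coord_vec_scaleR scaleR_conv_of_real)

lemma x_in_topspace: "x \<in> fst c \<Longrightarrow> x \<in> topspace X"
proof -
  assume x: "x \<in> fst c"
  have "(\<Union>c\<in>A. fst c) = topspace X" using manifold by (simp add: smooth_manifold_def)
  then show ?thesis using chart x by blast
qed

definition acs_coord :: "('a \<Rightarrow> ('a, 'e) tvec \<Rightarrow> ('a, 'e) tvec) \<Rightarrow> 'a \<Rightarrow> 'e \<Rightarrow> 'e" where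
  "acs_coord J x v = J x (coord_vec A c x v) c"

context
  fixes J x
  assumes J: "almost_complex_structure X A J" and x: "x \<in> fst c"
begin

lemma acs_tangent:
  assumes "\<xi> \<in> tangent_space A x"
  shows "J x \<xi> \<in> tangent_space A x" "J x (J x \<xi>) = - \<xi>"
    "\<eta> \<in> tangent_space A x \<Longrightarrow> J x (\<xi> + \<eta>) = J x \<xi> + J x \<eta>"
    "J x (tscale r \<xi>) = tscale r (J x \<xi>)"
proof -
  note c = bspec[OF conjunct1[OF J[unfolded almost_complex_structure_def]] x_in_topspace[OF x]]
  note * = conjunct1[OF c] conjunct1[OF conjunct2[OF c]] conjunct2[OF conjunct2[OF c]]
  show "J x \<xi> \<in> tangent_space A x" by (rule conjunct1[OF bspec[OF *(1) assms]])
  show "J x (J x \<xi>) = - \<xi>" by (rule conjunct2[OF bspec[OF *(1) assms]])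
  show "J x (\<xi> + \<eta>) = J x \<xi> + J x \<eta>" if "\<eta> \<in> tangent_space A x"
    by (rule bspec[OF bspec[OF *(2) assms] that])
  show "J x (tscale r \<xi>) = tscale r (J x \<xi>)" by (rule bspec[OF spec[OF *(3)] assms])
qed

lemma acs_coord_vec: "J x (coord_vec A c x v) = coord_vec A c x (acs_coord J x v)"
  unfolding acs_coord_def
  by (simp only: coord_vec_of_tangent[OF x acs_tangent(1)[OF coord_vec_in_tangent_space[OF x]]])

lemma linear_acs_coord: "linear (acs_coord J x)"
proof (rule linearI)
  note T = coord_vec_in_tangent_space[OF x]
  show "acs_coord J x (v + w) = acs_coord J x v + acs_coord J x w" for v w
    unfolding acs_coord_def coord_vec_add[OF x] acs_tangent(3)[OF T T] by simp
  show "acs_coord J x (r *\<^sub>R v) = r *\<^sub>R acs_coord J x v" for r v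
    unfolding acs_coord_def coord_vec_scaleR[OF x] acs_tangent(4)[OF T] by (simp add: tscale_def)
qed

lemma acs_coord_acs_coord: "acs_coord J x (acs_coord J x v) = - v"
proof -
  have "acs_coord J x (acs_coord J x v) = J x (J x (coord_vec A c x v)) c"
    by (simp only: acs_coord_vec coord_vec_self[OF x])
  also have "\<dots> = (- coord_vec A c x v) c"
    by (simp only: acs_tangent(2)[OF coord_vec_in_tangent_space[OF x]])
  finally show ?thesis by (simp add: coord_vec_self[OF x])
qed

lemma covectors10_coord:
  assumes "a \<in> covectors10 A J x"
  shows "a (coord_vec A c x (acs_coord J x v)) = \<i> * a (coord_vec A c x v)"
  using assms coord_vec_in_tangent_space[OF x]
  by (simp add: covectors10_def flip: acs_coord_vec)

text \<open>For a real functional \<open>h\<close> with \<open>h v \<noteq> 0\<close>, the form \<open>w \<mapsto> h w - \<i> h (J w)\<close> is of type (1,0)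
  and its real part at \<open>v\<close> is not 0. Here \<open>h\<close> is the inner product with \<open>v\<close>.\<close>

lemma covectors10_separate:
  assumes "v \<noteq> 0"
  obtains a where "a \<in> covectors10 A J x" "a (coord_vec A c x v) \<noteq> 0"
proof -
  define h where "h w = complex_of_real (v \<bullet> w) - \<i> * complex_of_real (v \<bullet> acs_coord J x w)" for w
  define a where "a \<xi> = (if \<xi> \<in> tangent_space A x then h (\<xi> c) else 0)" for \<xi>
  have a: "a (coord_vec A c x w) = h w" for w
    by (simp add: a_def coord_vec_in_tangent_space[OF x] coord_vec_self[OF x])
  note lin = linear_add[OF linear_acs_coord] linear_scale[OF linear_acs_coord] linear_neg[OF linear_acs_coord]
  have T: "\<exists>w. \<xi> = coord_vec A c x w" if "\<xi> \<in> tangent_space A x" for \<xi>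
    using coord_vec_of_tangent[OF x that] by metis
  have "a \<in> covectors10 A J x"
    unfolding covectors10_def covectors_def
  proof (intro CollectI conjI ballI allI impI)
    fix \<xi> \<eta> :: "('a, 'e) tvec" and r assume "\<xi> \<in> tangent_space A x"
    then obtain w where w: "\<xi> = coord_vec A c x w" using T by blast
    show "a (tscale r \<xi>) = complex_of_real r * a \<xi>"
      by (simp add: w a h_def lin algebra_simps flip: coord_vec_scaleR[OF x])
    show "a (J x \<xi>) = \<i> * a \<xi>"
      by (simp add: w a h_def acs_coord_vec acs_coord_acs_coord algebra_simps)
    assume "\<eta> \<in> tangent_space A x"
    then obtain u where u: "\<eta> = coord_vec A c x u" using T by blast
    show "a (\<xi> + \<eta>) = a \<xi> + a \<eta>"
      by (simp add: w u a h_def lin algebra_simps flip: coord_vec_add[OF x])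
  qed (simp add: a_def)
  moreover have "Re (h v) \<noteq> 0"
    using assms by (simp add: h_def)
  then have "a (coord_vec A c x v) \<noteq> 0"
    unfolding a by auto
  ultimately show ?thesis by (rule that)
qed

end

section \<open>Differential forms in a chart\<close>

lemma chart_inv_image: "y \<in> chart_image c \<Longrightarrow> chart_inv c y \<in> fst c"
  by (auto simp: chart_image_def chart_inv_left)

lemma chart_image_in: "x \<in> fst c \<Longrightarrow> snd c x \<in> chart_image c"
  by (simp add: chart_image_def)

lemma linear_form_coord:
  assumes "smooth_form X A \<alpha>" "y \<in> chart_image c"
  shows "linear (\<lambda>v. form_coord A c \<alpha> v y)"
  unfolding form_coord_def
  using assms chart_inv_image x_in_topspace
  by (intro linear_covector) (auto simp: smooth_form_def)

lemma form_coord_differentiable: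
  assumes "smooth_form X A \<alpha>" "x \<in> fst c"
  shows "form_coord A c \<alpha> v differentiable (at (snd c x))"
proof -
  have "Ck_on (Suc 0) (chart_image c) (form_coord A c \<alpha> v)"
    using assms chart unfolding smooth_form_def smooth_on_def by blast
  then show ?thesis using chart_image_in[OF assms(2)] by simp
qed

text \<open>The derivative in direction \<open>v\<close> of the coefficient \<open>\<alpha>(w)\<close>; its antisymmetrization is the
  exterior derivative.\<close>

definition dform :: "('a \<Rightarrow> ('a, 'e) tvec \<Rightarrow> complex) \<Rightarrow> 'a \<Rightarrow> 'e \<Rightarrow> 'e \<Rightarrow> complex" where
  "dform \<alpha> x v w = frechet_derivative (form_coord A c \<alpha> w) (at (snd c x)) v"

definition ext_deriv_coord :: "('a \<Rightarrow> ('a, 'e) tvec \<Rightarrow> complex) \<Rightarrow> 'a \<Rightarrow> 'e \<Rightarrow> 'e \<Rightarrow> complex" where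
  "ext_deriv_coord \<alpha> x v w = dform \<alpha> x v w - dform \<alpha> x w v"

lemma dform_has_derivative:
  assumes "smooth_form X A \<alpha>" "x \<in> fst c"
  shows "(form_coord A c \<alpha> w has_derivative (\<lambda>v. dform \<alpha> x v w)) (at (snd c x))"
  using form_coord_differentiable[OF assms]
  unfolding dform_def by (simp add: frechet_derivative_works)

lemma dform_eqI:
  assumes "(form_coord A c \<alpha> w has_derivative D) (at (snd c x))"
  shows "dform \<alpha> x v w = D v"
  using frechet_derivative_at[OF assms] by (simp add: dform_def)

lemma bilinear_dform:
  assumes \<alpha>: "smooth_form X A \<alpha>" and x: "x \<in> fst c"
  shows "bilinear_form (dform \<alpha> x)"
  unfolding bilinear_form_def
proof (intro conjI allI)
  show "linear (\<lambda>v. dform \<alpha> x v w)" for w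
    using dform_has_derivative[OF assms] has_derivative_linear by blast
  note D = dform_has_derivative[OF assms]
  note local = has_derivative_transform_within_open[OF _ open_chart_image chart_image_in[OF x]]
  show "linear (dform \<alpha> x v)" for v
  proof (rule linearI)
    show "dform \<alpha> x v (w + w') = dform \<alpha> x v w + dform \<alpha> x v w'" for w w'
      by (rule dform_eqI, rule local[OF has_derivative_add[OF D D]])
         (simp add: linear_add[OF linear_form_coord[OF \<alpha>]])
    show "dform \<alpha> x v (r *\<^sub>R w) = r *\<^sub>R dform \<alpha> x v w" for r w
      by (rule dform_eqI, rule local[OF has_derivative_scaleR_right[OF D]])
         (simp add: linear_scale[OF linear_form_coord[OF \<alpha>]])
  qed
qed

lemma bilinear_ext_deriv_coord:
  assumes "smooth_form X A \<alpha>" "x \<in> fst c"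
  shows "bilinear_form (ext_deriv_coord \<alpha> x)"
  using bilinear_dform[OF assms] unfolding bilinear_form_def linear_iff ext_deriv_coord_def
  by (simp add: algebra_simps)

lemma mubar_coord:
  assumes c: "c = (SOME c. c \<in> charts_at A x)" and x: "x \<in> fst c"
    and J: "almost_complex_structure X A J"
  shows "mubar A J \<alpha> x = (\<lambda>(\<xi>, \<eta>). if \<xi> \<in> tangent_space A x \<and> \<eta> \<in> tangent_space A x
     then type02_part (ext_deriv_coord \<alpha> x) (acs_coord J x) (\<xi> c, \<eta> c) / 4 else 0)"
proof (rule ext, clarsimp simp only: prod.case split_paired_all)
  fix \<xi> \<eta>
  have ed: "ext_deriv A \<alpha> x (\<xi>, \<eta>) = ext_deriv_coord \<alpha> x (\<xi> c) (\<eta> c)"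
    if "\<xi> \<in> tangent_space A x" "\<eta> \<in> tangent_space A x" for \<xi> \<eta>
    using that by (simp add: ext_deriv_def ext_deriv_coord_def dform_def Let_def flip: c)
  have Jc: "J x \<xi> c = acs_coord J x (\<xi> c)" if "\<xi> \<in> tangent_space A x" for \<xi>
    by (simp only: acs_coord_def coord_vec_of_tangent[OF x that])
  show "mubar A J \<alpha> x (\<xi>, \<eta>) = (if \<xi> \<in> tangent_space A x \<and> \<eta> \<in> tangent_space A x
     then type02_part (ext_deriv_coord \<alpha> x) (acs_coord J x) (\<xi> c, \<eta> c) / 4 else 0)"
    by (simp add: mubar_def proj02_def ed acs_tangent(1)[OF J x] Jc type02_part_def cbil_def
        clin_def graph_vec_def algebra_simps)
qed

lemma independent_family_mubar_iff:
  assumes c: "c = (SOME c. c \<in> charts_at A x)" and x: "x \<in> fst c"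
    and J: "almost_complex_structure X A J"
  shows "independent_family S (\<lambda>j. mubar A J (\<omega> j) x) \<longleftrightarrow>
    independent_family S (\<lambda>j. type02_part (ext_deriv_coord (\<omega> j) x) (acs_coord J x))"
proof -
  let ?t = "\<lambda>j. type02_part (ext_deriv_coord (\<omega> j) x) (acs_coord J x)"
  have "(\<forall>i. (\<Sum>j\<in>S. a j * mubar A J (\<omega> j) x i) = 0) \<longleftrightarrow> (\<forall>i. (\<Sum>j\<in>S. a j * ?t j i) = 0)" for a
  proof safe
    fix v w assume "\<forall>i. (\<Sum>j\<in>S. a j * mubar A J (\<omega> j) x i) = 0"
    from spec[OF this, of "(coord_vec A c x v, coord_vec A c x w)"]
    have "(\<Sum>j\<in>S. a j * ?t j (v, w)) / 4 = 0"
      by (simp add: mubar_coord[OF assms] coord_vec_in_tangent_space[OF x] coord_vec_self[OF x]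
          sum_divide_distrib)
    then show "(\<Sum>j\<in>S. a j * ?t j (v, w)) = 0" by simp
  next
    fix \<xi> \<eta> assume *: "\<forall>i. (\<Sum>j\<in>S. a j * ?t j i) = 0"
    have "(\<Sum>j\<in>S. a j * mubar A J (\<omega> j) x (\<xi>, \<eta>)) =
        (if \<xi> \<in> tangent_space A x \<and> \<eta> \<in> tangent_space A x
         then (\<Sum>j\<in>S. a j * ?t j (\<xi> c, \<eta> c)) / 4 else 0)"
      by (cases "\<xi> \<in> tangent_space A x"; cases "\<eta> \<in> tangent_space A x"; simp add: mubar_coord[OF assms] sum_divide_distrib)
    then show "(\<Sum>j\<in>S. a j * mubar A J (\<omega> j) x (\<xi>, \<eta>)) = 0" using * by simp
  qed
  then show ?thesis unfolding independent_family_def by simp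
qed

section \<open>Tensoriality\<close>

text \<open>The derivative of the vector field \<open>J w\<close> in direction \<open>v\<close>, for a constant coordinate field \<open>w\<close>.\<close>

definition acs_deriv :: "('a \<Rightarrow> ('a, 'e) tvec \<Rightarrow> ('a, 'e) tvec) \<Rightarrow> 'a \<Rightarrow> 'e \<Rightarrow> 'e \<Rightarrow> 'e" where
  "acs_deriv J x v w = frechet_derivative (\<lambda>y. acs_coord J (chart_inv c y) w) (at (snd c x)) v"

lemma acs_has_derivative:
  assumes "almost_complex_structure X A J" "x \<in> fst c"
  shows "((\<lambda>y. acs_coord J (chart_inv c y) w) has_derivative (\<lambda>v. acs_deriv J x v w)) (at (snd c x))"
proof -
  have "smooth_on (chart_image c) (\<lambda>y. J (chart_inv c y) (coord_vec A c (chart_inv c y) w) c)"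
    using assms(1) chart unfolding almost_complex_structure_def by blast
  then have "Ck_on (Suc 0) (chart_image c) (\<lambda>y. acs_coord J (chart_inv c y) w)"
    unfolding smooth_on_def acs_coord_def by blast
  then show ?thesis
    using chart_image_in[OF assms(2)] unfolding acs_deriv_def by (simp flip: frechet_derivative_works)
qed

text \<open>The Leibniz rule for \<open>\<alpha>(J w) = \<i> \<alpha>(w)\<close>, which holds near \<open>x\<close> for a (1,0)-form. Up to a term
  that depends on the value of \<open>\<alpha>\<close> at \<open>x\<close> only, the derivative of \<open>\<alpha>\<close> is thus of type (1,0) in
  its second argument.\<close>

lemma dform_acs_coord:
  assumes J: "almost_complex_structure X A J" and x: "x \<in> fst c" and \<alpha>: "smooth_form10 X A J \<alpha>"
  shows "dform \<alpha> x v (acs_coord J x w) =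
    \<i> * dform \<alpha> x v w - \<alpha> x (coord_vec A c x (acs_deriv J x v w))"
proof -
  define p where "p = snd c x"
  have \<alpha>': "smooth_form X A \<alpha>" using \<alpha> by (simp add: smooth_form10_def)
  have p: "p \<in> chart_image c" "chart_inv c p = x"
    using x by (simp_all add: p_def chart_image_in chart_inv_left)
  \<comment> \<open>In \<open>\<alpha>(J w)\<close> the form and its argument both vary; in terms of the basis this is a sum of
    products of functions.\<close>
  have "((\<lambda>y. \<Sum>b\<in>Basis. complex_of_real (acs_coord J (chart_inv c y) w \<bullet> b) * form_coord A c \<alpha> b y)
      has_derivative (\<lambda>v. \<Sum>b\<in>Basis. complex_of_real (acs_coord J (chart_inv c p) w \<bullet> b) * dform \<alpha> x v b +
        complex_of_real (acs_deriv J x v w \<bullet> b) * form_coord A c \<alpha> b p)) (at p)"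
    unfolding p_def
    by (intro has_derivative_sum has_derivative_mult has_derivative_of_real has_derivative_inner_left
        acs_has_derivative[OF J x] dform_has_derivative[OF \<alpha>' x])
  then have "((\<lambda>y. \<i> * form_coord A c \<alpha> w y) has_derivative
      (\<lambda>v. \<Sum>b\<in>Basis. complex_of_real (acs_coord J (chart_inv c p) w \<bullet> b) * dform \<alpha> x v b +
        complex_of_real (acs_deriv J x v w \<bullet> b) * form_coord A c \<alpha> b p)) (at p)"
  proof (rule has_derivative_transform_within_open[OF _ open_chart_image p(1)])
    fix y assume y: "y \<in> chart_image c"
    have "\<alpha> (chart_inv c y) \<in> covectors10 A J (chart_inv c y)"
      using \<alpha> x_in_topspace[OF chart_inv_image[OF y]] by (simp add: smooth_form10_def)
    from covectors10_coord[OF J chart_inv_image[OF y] this]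
    show "(\<Sum>b\<in>Basis. complex_of_real (acs_coord J (chart_inv c y) w \<bullet> b) * form_coord A c \<alpha> b y) =
        \<i> * form_coord A c \<alpha> w y"
      unfolding linear_eq_sum_Basis[OF linear_form_coord[OF \<alpha>' y], symmetric]
      by (simp add: form_coord_def)
  qed
  moreover have "((\<lambda>y. \<i> * form_coord A c \<alpha> w y) has_derivative (\<lambda>v. \<i> * dform \<alpha> x v w)) (at p)"
    unfolding p_def by (intro has_derivative_mult_right dform_has_derivative[OF \<alpha>' x])
  ultimately have "(\<lambda>v. \<i> * dform \<alpha> x v w) =
      (\<lambda>v. \<Sum>b\<in>Basis. complex_of_real (acs_coord J (chart_inv c p) w \<bullet> b) * dform \<alpha> x v b +
        complex_of_real (acs_deriv J x v w \<bullet> b) * form_coord A c \<alpha> b p)"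
    by (rule has_derivative_unique[rotated])
  from fun_cong[OF this, of v] have "\<i> * dform \<alpha> x v w =
      (\<Sum>b\<in>Basis. complex_of_real (acs_coord J x w \<bullet> b) * dform \<alpha> x v b +
        complex_of_real (acs_deriv J x v w \<bullet> b) * form_coord A c \<alpha> b p)"
    unfolding p(2) .
  also have "\<dots> = dform \<alpha> x v (acs_coord J x w) + form_coord A c \<alpha> (acs_deriv J x v w) p"
    using bilinear_dform[OF \<alpha>' x]
    by (simp add: sum.distrib bilinear_form_def linear_eq_sum_Basis[of "dform \<alpha> x v" "acs_coord J x w"]
        linear_eq_sum_Basis[OF linear_form_coord[OF \<alpha>' p(1)], of "acs_deriv J x v w"])
  finally show ?thesis by (simp add: form_coord_def p(2))
qed

text \<open>The value of \<open>mubar\<close> at \<open>x\<close> expressed by the value \<open>a\<close> of the form at \<open>x\<close>. For \<open>a\<close> of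
  type (1,0) it is \<open>a \<circ> N / 4\<close>, where \<open>N\<close> is the Nijenhuis tensor computed from constant coordinate
  fields.\<close>

definition mubar_symbol ::
  "('a \<Rightarrow> ('a, 'e) tvec \<Rightarrow> ('a, 'e) tvec) \<Rightarrow> 'a \<Rightarrow> (('a, 'e) tvec \<Rightarrow> complex) \<Rightarrow>
   ('a, 'e) tvec \<times> ('a, 'e) tvec \<Rightarrow> complex" where
  "mubar_symbol J x a = (\<lambda>(\<xi>, \<eta>). if \<xi> \<in> tangent_space A x \<and> \<eta> \<in> tangent_space A x then
     (let v = \<xi> c; w = \<eta> c; k = (\<lambda>v w. a (coord_vec A c x (acs_deriv J x v w))) in
       (k (acs_coord J x v) w - k (acs_coord J x w) v - \<i> * (k v w - k w v)) / 4)
     else 0)"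

text \<open>By \<open>dform_acs_coord\<close> the bilinear form \<open>dform \<alpha> x\<close> has no (0,2)-part apart from terms in the
  value \<open>\<alpha> x\<close>. The same holds for its transpose, and hence for the exterior derivative.\<close>

lemma mubar_eq_symbol:
  assumes c: "c = (SOME c. c \<in> charts_at A x)" and x: "x \<in> fst c"
    and J: "almost_complex_structure X A J" and \<alpha>: "smooth_form10 X A J \<alpha>"
  shows "mubar A J \<alpha> x = mubar_symbol J x (\<alpha> x)"
  by (rule ext)
     (simp add: mubar_coord[OF c x J] mubar_symbol_def type02_part_def cbil_def clin_def graph_vec_def
       ext_deriv_coord_def dform_acs_coord[OF J x \<alpha>] Let_def algebra_simps split: prod.split)

lemma mubar_symbol_sum:
  "mubar_symbol J x (\<lambda>\<xi>. \<Sum>j\<in>S. r j * a j \<xi>) = (\<lambda>i. \<Sum>j\<in>S. r j * mubar_symbol J x (a j) i)"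
proof (rule ext)
  fix i :: "('a, 'e) tvec \<times> ('a, 'e) tvec"
  obtain \<xi> \<eta> where i: "i = (\<xi>, \<eta>)" by (cases i)
  show "mubar_symbol J x (\<lambda>\<xi>. \<Sum>j\<in>S. r j * a j \<xi>) i = (\<Sum>j\<in>S. r j * mubar_symbol J x (a j) i)"
    unfolding i mubar_symbol_def prod.case Let_def
    by (cases "\<xi> \<in> tangent_space A x"; cases "\<eta> \<in> tangent_space A x";
        simp add: sum_subtractf sum_distrib_left sum_divide_distrib
          algebra_simps diff_divide_distrib add_divide_distrib sum.distrib)
qed

section \<open>The Nijenhuis rank through a co-frame\<close>

text \<open>Combinations of a global co-frame with constant coefficients extend every (1,0)-covector at a
  point to a smooth (1,0)-form.\<close>

lemma smooth_form10_linear_combination: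
  assumes J: "almost_complex_structure X A J" and \<omega>: "\<And>j. j \<in> I \<Longrightarrow> smooth_form10 X A J (\<omega> j)"
  shows "smooth_form10 X A J (\<lambda>x \<xi>. \<Sum>j\<in>I. a j * \<omega> j x \<xi>)"
  unfolding smooth_form10_def smooth_form_def
proof (intro conjI ballI allI)
  fix x assume x: "x \<in> topspace X"
  have *: "\<omega> j x \<in> covectors10 A J x" if "j \<in> I" for j
    using \<omega>[OF that] x by (simp add: smooth_form10_def)
  show "(\<lambda>\<xi>. \<Sum>j\<in>I. a j * \<omega> j x \<xi>) \<in> covectors A x"
    using * unfolding covectors10_def covectors_def
    by (simp add: algebra_simps sum.distrib sum_distrib_left)
  then show "(\<lambda>\<xi>. \<Sum>j\<in>I. a j * \<omega> j x \<xi>) \<in> covectors10 A J x"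
    using * unfolding covectors10_def
    by (simp add: algebra_simps sum_distrib_left)
next
  fix c' v assume c': "c' \<in> A"
  have "Ck_on k (chart_image c') (form_coord A c' (\<omega> j) v)" if "j \<in> I" for k j
    using \<omega>[OF that] c' by (simp add: smooth_form10_def smooth_form_def smooth_on_def)
  moreover have "open (chart_image c')"
    using manifold c' by (simp add: smooth_manifold_def)
  ultimately have "smooth_on (chart_image c') (\<lambda>y. \<Sum>j\<in>I. a j * form_coord A c' (\<omega> j) v y)"
    unfolding smooth_on_def by (intro allI Ck_on_linear_combination)
  then show "smooth_on (chart_image c') (form_coord A c' (\<lambda>x \<xi>. \<Sum>j\<in>I. a j * \<omega> j x \<xi>) v)"
    by (simp add: form_coord_def[abs_def])
qed

lemma coframe10_smooth_form10:
  assumes "coframe10 X A J m \<omega>" "j \<in> {1..m}"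
  shows "smooth_form10 X A J (\<omega> j)"
proof -
  have "\<omega> j x \<in> covectors10 A J x" if "x \<in> topspace X" for x
  proof -
    have "cfun.span ((\<lambda>j. \<omega> j x) ` {1..m}) = covectors10 A J x"
      using assms(1) that by (simp add: coframe10_def)
    moreover have "\<omega> j x \<in> cfun.span ((\<lambda>j. \<omega> j x) ` {1..m})"
      using assms(2) by (intro cfun.span_base imageI)
    ultimately show ?thesis by simp
  qed
  then show ?thesis
    using assms by (simp add: coframe10_def smooth_form10_def)
qed

lemma coframe10_separates:
  assumes J: "almost_complex_structure X A J" and \<omega>: "coframe10 X A J m \<omega>" and x: "x \<in> fst c"
    and 0: "\<And>j. j \<in> {1..m} \<Longrightarrow> \<omega> j x (coord_vec A c x v) = 0"
  shows "v = 0"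
proof (rule ccontr)
  assume "v \<noteq> 0"
  then obtain a where a: "a \<in> covectors10 A J x" "a (coord_vec A c x v) \<noteq> 0"
    using covectors10_separate[OF J x] by blast
  then have "a \<in> cfun.span ((\<lambda>j. \<omega> j x) ` {1..m})"
    using \<omega> x_in_topspace[OF x] by (simp add: coframe10_def)
  then obtain r where "a = (\<lambda>\<xi>. \<Sum>j\<in>{1..m}. r j * \<omega> j x \<xi>)"
    unfolding in_span_image_iff[OF finite_atLeastAtMost] by (elim exE)
  then show False using a(2) 0 by simp
qed

text \<open>Every (1,0)-covector at \<open>x\<close> extends to a constant combination of the co-frame, and any other
  extension has the same image because \<open>mubar\<close> is tensorial. So the fibrewise map sends a combination of
  the \<open>\<omega> j x\<close> to the same combination of the \<open>mubar A J (\<omega> j) x\<close>.\<close>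

lemma nijenhuis_rank_eq_dim_mubar:
  assumes c: "c = (SOME c. c \<in> charts_at A x)" and x: "x \<in> fst c"
    and J: "almost_complex_structure X A J" and \<omega>: "coframe10 X A J m \<omega>"
  shows "nijenhuis_rank X A J x = cfun.dim ((\<lambda>j. mubar A J (\<omega> j) x) ` {1..m})"
proof -
  let ?I = "{1..m}" and ?L = "mubar_symbol J x"
  let ?comb = "\<lambda>a \<xi>. \<Sum>j\<in>?I. a j * \<omega> j x \<xi>"
  have "covectors10 A J x = cfun.span ((\<lambda>j. \<omega> j x) ` ?I)"
    using \<omega> x_in_topspace[OF x] by (simp add: coframe10_def)
  then have span: "b \<in> covectors10 A J x \<longleftrightarrow> (\<exists>a. b = ?comb a)" for b
    by (simp only: in_span_image_iff[OF finite_atLeastAtMost])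
  have at: "mubar_at X A J x (?comb a) = ?L (?comb a)" for a
    unfolding mubar_at_def
  proof (rule the_equality)
    show "\<exists>\<alpha>. smooth_form10 X A J \<alpha> \<and> \<alpha> x = ?comb a \<and> mubar A J \<alpha> x = ?L (?comb a)"
    proof (intro exI conjI)
      show s: "smooth_form10 X A J (\<lambda>x \<xi>. \<Sum>j\<in>?I. a j * \<omega> j x \<xi>)"
        by (rule smooth_form10_linear_combination[OF J coframe10_smooth_form10[OF \<omega>]])
      show "mubar A J (\<lambda>x \<xi>. \<Sum>j\<in>?I. a j * \<omega> j x \<xi>) x = ?L (?comb a)"
        by (rule mubar_eq_symbol[OF c x J s])
    qed (rule refl)
    fix b assume "\<exists>\<alpha>. smooth_form10 X A J \<alpha> \<and> \<alpha> x = ?comb a \<and> mubar A J \<alpha> x = b"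
    then show "b = ?L (?comb a)" using mubar_eq_symbol[OF c x J] by metis
  qed
  have L: "?L (?comb a) = (\<lambda>i. \<Sum>j\<in>?I. a j * mubar A J (\<omega> j) x i)" for a
    unfolding mubar_symbol_sum
    by (intro ext sum.cong refl) (simp only: mubar_eq_symbol[OF c x J coframe10_smooth_form10[OF \<omega>]])
  have "mubar_at X A J x ` covectors10 A J x = cfun.span ((\<lambda>j. mubar A J (\<omega> j) x) ` ?I)"
  proof (rule set_eqI)
    fix h
    have "h \<in> mubar_at X A J x ` covectors10 A J x \<longleftrightarrow> (\<exists>a. h = mubar_at X A J x (?comb a))"
      unfolding image_iff Bex_def span by blast
    then show "h \<in> mubar_at X A J x ` covectors10 A J x \<longleftrightarrow>
        h \<in> cfun.span ((\<lambda>j. mubar A J (\<omega> j) x) ` ?I)"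
      by (simp only: in_span_image_iff[OF finite_atLeastAtMost] at L)
  qed
  then show ?thesis by (simp add: nijenhuis_rank_def cfun.dim_span)
qed

end

section \<open>Deformations of almost complex structures\<close>

theorem theoremA:
  fixes X :: "'a topology"
    and A :: "('a, 'e::euclidean_space) chart set"
    and m :: nat
    and J0 J1 :: "'a \<Rightarrow> ('a, 'e) tvec \<Rightarrow> ('a, 'e) tvec"
    and J :: "complex \<Rightarrow> 'a \<Rightarrow> ('a, 'e) tvec \<Rightarrow> ('a, 'e) tvec"
    and \<phi> :: "nat \<Rightarrow> 'a \<Rightarrow> ('a, 'e) tvec \<Rightarrow> complex"
    and f :: "nat \<Rightarrow> nat \<Rightarrow> 'a \<Rightarrow> complex"
    and \<epsilon>0 :: real
  assumes "smooth_manifold X A" and "DIM('e) = 2 * m" and "parallelizable X A"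
    and "almost_complex_structure X A J0" and "coframe10 X A J0 m \<phi>"
    and "\<And>j k. j \<in> {1..m} \<Longrightarrow> k \<in> {1..m} \<Longrightarrow> smooth_fun A (f j k)"
    and "almost_complex_structure X A J1" and "coframe10 X A J1 m (deformed_coframe m \<phi> f 1)"
    and "0 < \<epsilon>0"
    and "\<And>s. cmod s < \<epsilon>0 \<Longrightarrow> almost_complex_structure X A (J s)"
    and "\<And>s. cmod s < \<epsilon>0 \<Longrightarrow> coframe10 X A (J s) m (deformed_coframe m \<phi> f s)"
  shows "\<forall>x\<in>topspace X. \<exists>\<epsilon>>0. \<epsilon> \<le> \<epsilon>0 \<and>
           (\<forall>s. 0 < cmod s \<and> cmod s < \<epsilon> \<longrightarrow>
              max (nijenhuis_rank X A J0 x) (nijenhuis_rank X A J1 x)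
                \<le> nijenhuis_rank X A (J s) x)"
proof
  fix x assume x_top: "x \<in> topspace X"
  define c where c: "c = (SOME c. c \<in> charts_at A x)"
  have "x \<in> (\<Union>c\<in>A. fst c)"
    using assms(1) x_top by (simp add: smooth_manifold_def)
  then have "\<exists>c. c \<in> charts_at A x"
    unfolding charts_at_def by blast
  then have "c \<in> charts_at A x" unfolding c by (rule someI_ex)
  then have cA: "c \<in> A" and x: "x \<in> fst c" by (simp_all add: charts_at_def)
  interpret manifold_chart X A c using assms(1) cA by unfold_locales
  let ?I = "{1..m}"
  define \<omega> where "\<omega> = deformed_coframe m \<phi> f"
  have \<omega>0: "\<omega> 0 = \<phi>" by (simp add: \<omega>_def deformed_coframe_def fun_eq_iff)
  have \<omega>_pencil: "\<omega> s j y \<xi> = (1 - s) * \<phi> j y \<xi> + s * \<omega> 1 j y \<xi>" for s j y \<xi>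
    by (simp add: \<omega>_def deformed_coframe_def algebra_simps)
  define b0 b1 \<beta> where "b0 j = ext_deriv_coord (\<phi> j) x" and "b1 j = ext_deriv_coord (\<omega> 1 j) x"
    and "\<beta> s j = (\<lambda>v w. (1 - s) * b0 j v w + s * b1 j v w)" for s j
  have smooth: "smooth_form X A (\<phi> j)" "smooth_form X A (\<omega> 1 j)" if "j \<in> ?I" for j
    using assms(5,8) that by (simp_all add: coframe10_def \<omega>_def)
  have \<beta>: "ext_deriv_coord (\<omega> s j) x = \<beta> s j" if j: "j \<in> ?I" for s j
  proof -
    have "(form_coord A c (\<omega> s j) w has_derivative
        (\<lambda>v. (1 - s) * dform (\<phi> j) x v w + s * dform (\<omega> 1 j) x v w)) (at (snd c x))" for w
    proof -
      have "form_coord A c (\<omega> s j) w =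
          (\<lambda>y. (1 - s) * form_coord A c (\<phi> j) w y + s * form_coord A c (\<omega> 1 j) w y)"
        unfolding form_coord_def by (rule ext) (rule \<omega>_pencil)
      then show ?thesis
        using smooth[OF j] x
        by (simp only:) (intro has_derivative_add has_derivative_mult_right dform_has_derivative)
    qed
    from dform_eqI[OF this] show ?thesis
      unfolding \<beta>_def b0_def b1_def
      by (intro ext) (simp only: ext_deriv_coord_def, simp add: algebra_simps)
  qed
  define \<phi>' where "\<phi>' j v = \<phi> j x (coord_vec A c x v)" for j v
  define F where "F j k = f j k x" for j k
  have \<omega>': "\<omega> s j x (coord_vec A c x v) = \<phi>' j v + s * (\<Sum>k\<in>?I. F j k * cnj (\<phi>' k v))" for s j v
    by (simp add: \<omega>_def deformed_coframe_def \<phi>'_def F_def)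
  have type10: "\<omega> s j x (coord_vec A c x (acs_coord K x v)) = \<i> * \<omega> s j x (coord_vec A c x v)"
    if "almost_complex_structure X A K" "coframe10 X A K m (\<omega> s)" "j \<in> ?I" for s K j v
    using coframe10_smooth_form10[OF that(2,3)] x_top covectors10_coord[OF that(1) x]
    by (simp add: smooth_form10_def)
  have cof0: "coframe10 X A J0 m (\<omega> 0)" and cof1: "coframe10 X A J1 m (\<omega> 1)"
    using assms(5,8) by (simp_all add: \<omega>0) (simp add: \<omega>_def)
  interpret P: coframe_pencil ?I \<phi>' F "acs_coord J0 x" "acs_coord J1 x"
    "\<lambda>s j v. \<phi>' j v + s * (\<Sum>k\<in>?I. F j k * cnj (\<phi>' k v))"
  proof (rule coframe_pencil.intro, goal_cases)
    case (1 j)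
    then show ?case
      using smooth(1)[OF 1] x_top unfolding \<phi>'_def
      by (intro linear_covector[OF _ x]) (simp add: smooth_form_def)
  next
    case 2
    show ?case by (rule acs_coord_acs_coord[OF assms(4) x])
  next
    case 3
    show ?case by (rule linear_acs_coord[OF assms(4) x])
  next
    case 4
    show ?case by (rule linear_acs_coord[OF assms(7) x])
  next
    case (5 j v)
    then show ?case using type10[OF assms(4) cof0, of j v] by (simp add: \<omega>')
  next
    case (6 j v)
    then show ?case using type10[OF assms(7) cof1, of j v] by (simp add: \<omega>')
  next
    case (7 v)
    then show ?case
      using coframe10_separates[OF assms(4,5) x, of v] by (simp add: \<phi>'_def)
  qed
  have structure_at: "P.structure_at s (acs_coord K x)"
    if "almost_complex_structure X A K" "coframe10 X A K m (\<omega> s)" for s K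
    unfolding P.structure_at_def
    using type10[OF that] coframe10_separates[OF that x] unfolding \<omega>' by blast
  have rank: "nijenhuis_rank X A K x = cfun.dim ((\<lambda>j. mubar A K (\<omega> s j) x) ` ?I)"
    if "almost_complex_structure X A K" "coframe10 X A K m (\<omega> s)" for s K
    using nijenhuis_rank_eq_dim_mubar[OF c x that] .
  have indep: "independent_family S (\<lambda>j. mubar A K (\<omega> s j) x) \<longleftrightarrow>
      independent_family S (\<lambda>j. type02_part (\<beta> s j) (acs_coord K x))"
    if "almost_complex_structure X A K" "S \<subseteq> ?I" for S K s
  proof -
    have "independent_family S (\<lambda>j. type02_part (ext_deriv_coord (\<omega> s j) x) (acs_coord K x)) \<longleftrightarrow>
        independent_family S (\<lambda>j. type02_part (\<beta> s j) (acs_coord K x))"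
      unfolding independent_family_def using that(2) \<beta> by (simp add: subset_iff cong: sum.cong)
    then show ?thesis
      using independent_family_mubar_iff[OF c x that(1)] by blast
  qed
  \<comment> \<open>Applied below to \<open>J0\<close> and to \<open>J1\<close>: members of the co-frame that realize the rank at \<open>s0\<close> stay
    independent for all but finitely many \<open>s\<close>.\<close>
  have generic: "finite {s. cmod s < \<epsilon>0 \<and> nijenhuis_rank X A (J s) x < nijenhuis_rank X A K x}"
    if K: "almost_complex_structure X A K" "coframe10 X A K m (\<omega> s0)" and s0: "s0 = 0 \<or> s0 = 1"
    for s0 K
  proof -
    obtain S where S: "S \<subseteq> ?I" "independent_family S (\<lambda>j. mubar A K (\<omega> s0 j) x)"
      "card S = nijenhuis_rank X A K x"
      using obtain_independent_subfamily[of ?I "\<lambda>j. mubar A K (\<omega> s0 j) x"] rank[OF K] by auto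
    have bil: "bilinear_form (b0 j)" "bilinear_form (b1 j)" if "j \<in> S" for j
      using that S(1) smooth x by (auto simp: b0_def b1_def intro!: bilinear_ext_deriv_coord)
    have "finite {s. \<exists>K. P.structure_at s K \<and>
        \<not> independent_family S (\<lambda>j. type02_part (\<beta> s j) K)}"
    proof (rule P.finite_dependent_type02_parts)
      show "finite S" using S(1) finite_subset by blast
      show "independent_family S (\<lambda>j. type02_part (\<beta> s0 j) (acs_coord K x))"
        using S(2) indep[OF K(1) S(1)] by blast
      show "\<beta> s j = (\<lambda>v w. (1 - s) * b0 j v w + s * b1 j v w)" for s j
        by (rule \<beta>_def)
    qed (use S(1) bil s0 structure_at[OF K] in auto)
    moreover have "independent_family S (\<lambda>j. type02_part (\<beta> s j) (acs_coord (J s) x)) \<Longrightarrow>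
        nijenhuis_rank X A K x \<le> nijenhuis_rank X A (J s) x" if s: "cmod s < \<epsilon>0" for s
    proof -
      note Js = assms(10)[OF s] assms(11)[OF s, folded \<omega>_def]
      assume "independent_family S (\<lambda>j. type02_part (\<beta> s j) (acs_coord (J s) x))"
      then have "independent_family S (\<lambda>j. mubar A (J s) (\<omega> s j) x)"
        using indep[OF Js(1) S(1)] by blast
      from card_le_dim_image[OF finite_atLeastAtMost S(1) this]
      show ?thesis by (simp add: S(3) rank[OF Js])
    qed
    then have "{s. cmod s < \<epsilon>0 \<and> nijenhuis_rank X A (J s) x < nijenhuis_rank X A K x}
        \<subseteq> {s. \<exists>K. P.structure_at s K \<and> \<not> independent_family S (\<lambda>j. type02_part (\<beta> s j) K)}"
      using structure_at[OF assms(10) assms(11)[folded \<omega>_def]] by force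
    ultimately show ?thesis by (rule finite_subset[rotated])
  qed
  define bad where "bad = {s. cmod s < \<epsilon>0 \<and> nijenhuis_rank X A (J s) x < nijenhuis_rank X A J0 x}
    \<union> {s. cmod s < \<epsilon>0 \<and> nijenhuis_rank X A (J s) x < nijenhuis_rank X A J1 x}"
  have "finite bad"
    unfolding bad_def using generic[OF assms(4) cof0] generic[OF assms(7) cof1] by simp
  then obtain d where d: "d > 0" "\<And>s. s \<in> bad \<Longrightarrow> s \<noteq> 0 \<Longrightarrow> d \<le> cmod s"
    using finite_set_avoid[of bad 0] by auto
  show "\<exists>\<epsilon>>0. \<epsilon> \<le> \<epsilon>0 \<and> (\<forall>s. 0 < cmod s \<and> cmod s < \<epsilon> \<longrightarrow>
      max (nijenhuis_rank X A J0 x) (nijenhuis_rank X A J1 x) \<le> nijenhuis_rank X A (J s) x)"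
  proof (intro exI[of _ "min d \<epsilon>0"] conjI allI impI)
    fix s assume s: "0 < cmod s \<and> cmod s < min d \<epsilon>0"
    then have "s \<notin> bad" using d(2)[of s] by auto
    then show "max (nijenhuis_rank X A J0 x) (nijenhuis_rank X A J1 x) \<le> nijenhuis_rank X A (J s) x"
      using s by (auto simp: bad_def)
  qed (use d(1) assms(9) in auto)
qed

end
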